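(* Let $\tilde{x}_k$ be the $k$-th iterate of the randomized block Kaczmarz (RBK) method applied to the doubly noisy linear system $\widetilde{A}x=\tilde{b}$. Let $x_{LS}=A^{\dagger}b$ and $\tilde{x}_{LS}=\widetilde{A}^{\dagger}\tilde{b}$ be the least-squares solutions of the noiseless system $Ax=b$ and of the doubly noisy system $\widetilde{A}x=\tilde{b}$, respectively. Consider the row partition $\widetilde{A}=(\widetilde{A}_{\tau_1}^{\top},\widetilde{A}_{\tau_2}^{\top},\dots,\widetilde{A}_{\tau_p}^{\top})^{\top}$ with row paving $(p,\alpha_1,\alpha_2)$. For each $i$ let $\widetilde{A}_{\tau_i}=U_i\Sigma_iV_i^{\top}$ be the full singular value decomposition of the row block $\widetilde{A}_{\tau_i}$, let $r_i=\operatorname{rank}(\widetilde{A}_{\tau_i})$, and partition $V_i=[V_{r_i}\mid V_{n-r_i}]$ with $V_{r_i}\in\mathbb{R}^{n\times r_i}$ and $V_{n-r_i}\in\mathbb{R}^{n\times(n-r_i)}$. If the matrix $$\widetilde{A}_{\tau}=\frac{1}{\|\widetilde{A}\|_F}\left(\|\widetilde{A}_{\tau_1}\|_FV_{r_1},\ \|\widetilde{A}_{\tau_2}\|_FV_{r_2},\ \ldots,\ \|\widetilde{A}_{\tau_p}\|_FV_{r_p}\right)\in\mathbb{R}^{n\times\sum_{i=1}^pr_i}$$ has full row rank, then for any initial point $\tilde{x}_0\in\mathbb{R}^n$ and any positive integer $k$, $$\|\mathbb{E}(\tilde{x}_k-x_{LS})\|_2\le(1-\eta)^k\|\tilde{x}_0-x_{LS}\|_2+\frac{\cos\theta_{\gamma}\left(\|\tilde{x}_{LS}\|_2+\frac{\|\tilde{r}\|_2}{\sqrt{\alpha_1}}\right)+\|e_{LS}\|_2}{\eta},$$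 where $$\cos\theta_{\gamma}=\max_{i\in\{1,\dots,p\}}\cos\angle\left(\tilde{x}_{LS}-\tilde{x}_{LS}^{(i)},\ \mathcal{R}(\widetilde{A}_{\tau_i}^{\top})\right),$$ $\eta=\lambda_{\min}(\widetilde{A}_{\tau}\widetilde{A}_{\tau}^{\top})$, $\tilde{r}=\tilde{b}-\widetilde{A}\tilde{x}_{LS}$, and $e_{LS}=x_{LS}-\tilde{x}_{LS}$.
   Context: $A,\widetilde{A}\in\mathbb{R}^{m\times n}$ and $b,\tilde{b}\in\mathbb{R}^m$ are fixed (deterministic); $\widetilde{A},\tilde{b}$ are noisy versions of $A,b$. Neither $Ax=b$ nor $\widetilde{A}x=\tilde{b}$ is assumed consistent. $M^{\dagger}$ is the Moore-Penrose inverse, $\mathcal{R}(\cdot)$ denotes range, $\|\cdot\|_F$ is the Frobenius norm, $\lambda_{\min},\lambda_{\max}$ are the smallest and largest eigenvalues of a symmetric matrix. $\{\tau_1,\dots,\tau_p\}$ is a partition of the row indices $\{1,\dots,m\}$; $\widetilde{A}_{\tau_i}\in\mathbb{R}^{|\tau_i|\times n}$ is the row submatrix of $\widetilde{A}$ indexed by $\tau_i$ and $\tilde{b}_{\tau_i}$ the corresponding subvector of $\tilde{b}$. It is a row paving $(p,\alpha_1,\alpha_2)$ of $\widetilde{A}$ if $$\alpha_1\le\lambda_{\min}(\widetilde{A}_{\tau_i}\widetilde{A}_{\tau_i}^{\top})\quad\text{and}\quad\lambda_{\max}(\widetilde{A}_{\tau_i}\widetilde{A}_{\tau_i}^{\top})\le\alpha_2\quad\text{for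 each }i\in\{1,\dots,p\},$$ where $\alpha_1>0$. $\tilde{x}_{LS}^{(i)}=\widetilde{A}_{\tau_i}^{\dagger}\tilde{b}_{\tau_i}$ is the least-squares solution of the subsystem $\widetilde{A}_{\tau_i}x=\tilde{b}_{\tau_i}$. For a vector $v\ne0$ and a subspace $V$, $\cos\angle(v,V)=\|P_Vv\|_2/\|v\|_2$ with $P_V$ the orthogonal projector onto $V$ (for $v=0$ the value is taken to be $0$). RBK method: starting from $\tilde{x}_0$, at step $k=1,2,\dots$ an index $i_k\in\{1,\dots,p\}$ is drawn, independently of the past, with probability $\mathbb{P}(i_k=i)=\|\widetilde{A}_{\tau_i}\|_F^2/\|\widetilde{A}\|_F^2$, and $$\tilde{x}_k=\tilde{x}_{k-1}+\widetilde{A}_{\tau_{i_k}}^{\dagger}\left(\tilde{b}_{\tau_{i_k}}-\widetilde{A}_{\tau_{i_k}}\tilde{x}_{k-1}\right).$$ $\mathbb{E}$ denotes expectation over all random index choices. *)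

theory Defs
  imports
    "HOL-Probability.Probability"
    "Jordan_Normal_Form.Spectral_Radius"
    "Jordan_Normal_Form.DL_Rank"
    "Jordan_Normal_Form.DL_Submatrix"
begin

unbundle no vec_syntax and no inner_syntax

hide_const (open) Finite_Cartesian_Product.vec Finite_Cartesian_Product.mat
  Finite_Cartesian_Product.row Finite_Cartesian_Product.rows
hide_type (open) Finite_Cartesian_Product.vec

text \<open>
  Row and column indices of matrices are 0-based, as in \<^theory>\<open>Jordan_Normal_Form.Matrix\<close>;
  the blocks of a row partition and the steps of the iteration are numbered from 1.
\<close>

definition vnorm :: "real vec \<Rightarrow> real" where
  "vnorm v = sqrt (v \<bullet> v)"

definition frob_norm :: "real mat \<Rightarrow> real" where
  "frob_norm M = sqrt (\<Sum>i<dim_row M. \<Sum>j<dim_col M. (M $$ (i, j))\<^sup>2)"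

text \<open>The next two are meant for symmetric matrices of positive dimension, for which the
  real spectrum is nonempty and contains all complex eigenvalues.\<close>

definition lambda_min :: "real mat \<Rightarrow> real" where
  "lambda_min M = Min (spectrum M)"

definition lambda_max :: "real mat \<Rightarrow> real" where
  "lambda_max M = Max (spectrum M)"

text \<open>The four Penrose equations, which have exactly one solution for every real matrix.\<close>

definition is_pinv :: "real mat \<Rightarrow> real mat \<Rightarrow> bool" where
  "is_pinv M X \<longleftrightarrow>
     X \<in> carrier_mat (dim_col M) (dim_row M) \<and>
     M * X * M = M \<and> X * M * X = X \<and> (M * X)\<^sup>T = M * X \<and> (X * M)\<^sup>T = X * M"

definition pinv :: "real mat \<Rightarrow> real mat" where
  "pinv M = (THE X. is_pinv M X)"

definition orth_proj :: "real vec set \<Rightarrow> real vec \<Rightarrow> real vec" where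
  "orth_proj W v = (THE w. w \<in> W \<and> (\<forall>u\<in>W. (v - w) \<bullet> u = 0))"

definition cos_angle :: "real vec \<Rightarrow> real vec set \<Rightarrow> real" where
  "cos_angle v W = (if v = 0\<^sub>v (dim_vec v) then 0 else vnorm (orth_proj W v) / vnorm v)"

definition row_block :: "real mat \<Rightarrow> nat set \<Rightarrow> real mat" where
  "row_block M I = submatrix M I UNIV"

text \<open>Entries are taken in increasing order of their index, matching
  \<^const>\<open>submatrix\<close>.\<close>

definition subvec :: "real vec \<Rightarrow> nat set \<Rightarrow> real vec" where
  "subvec v I = vec (card {i. i < dim_vec v \<and> i \<in> I}) (\<lambda>i. v $ pick I i)"

definition row_partition :: "nat \<Rightarrow> nat \<Rightarrow> (nat \<Rightarrow> nat set) \<Rightarrow> bool" where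
  "row_partition m p \<tau> \<longleftrightarrow>
     (\<forall>i\<in>{1..p}. \<tau> i \<noteq> {}) \<and> disjoint_family_on \<tau> {1..p} \<and> (\<Union>i\<in>{1..p}. \<tau> i) = {..<m}"

definition row_paving :: "real mat \<Rightarrow> (nat \<Rightarrow> nat set) \<Rightarrow> nat \<Rightarrow> real \<Rightarrow> real \<Rightarrow> bool" where
  "row_paving M \<tau> p \<alpha>\<^sub>1 \<alpha>\<^sub>2 \<longleftrightarrow>
     row_partition (dim_row M) p \<tau> \<and> 0 < \<alpha>\<^sub>1 \<and>
     (\<forall>i\<in>{1..p}. \<alpha>\<^sub>1 \<le> lambda_min (row_block M (\<tau> i) * (row_block M (\<tau> i))\<^sup>T) \<and>
                  lambda_max (row_block M (\<tau> i) * (row_block M (\<tau> i))\<^sup>T) \<le> \<alpha>\<^sub>2)"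

text \<open>The library's \<^const>\<open>orthogonal_mat\<close> does not require normalised columns.\<close>

definition orthonormal_mat :: "real mat \<Rightarrow> bool" where
  "orthonormal_mat Q \<longleftrightarrow> square_mat Q \<and> inverts_mat Q Q\<^sup>T \<and> inverts_mat Q\<^sup>T Q"

text \<open>Singular values are listed in nonincreasing order, so that the first
  \<open>rank M\<close> columns of \<open>V\<close> are those belonging to the nonzero ones.\<close>

definition full_svd :: "real mat \<Rightarrow> real mat \<Rightarrow> real mat \<Rightarrow> real mat \<Rightarrow> bool" where
  "full_svd M U S V \<longleftrightarrow>
     U \<in> carrier_mat (dim_row M) (dim_row M) \<and> orthonormal_mat U \<and>
     V \<in> carrier_mat (dim_col M) (dim_col M) \<and> orthonormal_mat V \<and>
     S \<in> carrier_mat (dim_row M) (dim_col M) \<and> diagonal_mat S \<and>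
     (\<forall>j < min (dim_row M) (dim_col M). 0 \<le> S $$ (j, j)) \<and>
     (\<forall>j k. j \<le> k \<and> k < min (dim_row M) (dim_col M) \<longrightarrow> S $$ (k, k) \<le> S $$ (j, j)) \<and>
     M = U * S * V\<^sup>T"

definition mat_rank :: "real mat \<Rightarrow> nat" where
  "mat_rank M = vec_space.rank (dim_row M) M"

definition leading_cols :: "nat \<Rightarrow> real mat \<Rightarrow> real mat" where
  "leading_cols r V = mat_of_cols (dim_row V) (take r (cols V))"

text \<open>The horizontal concatenation of the matrices
  \<open>\<parallel>M\<^bsub>\<tau> i\<^esub>\<parallel>\<^sub>F V\<^bsub>r i\<^esub>\<close>, where
  \<open>V\<^bsub>r i\<^esub>\<close> consists of the first \<open>rank M\<^bsub>\<tau> i\<^esub>\<close>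
  columns of \<open>V i\<close>, divided by \<open>\<parallel>M\<parallel>\<^sub>F\<close>.\<close>

definition block_V_mat ::
    "real mat \<Rightarrow> (nat \<Rightarrow> nat set) \<Rightarrow> nat \<Rightarrow> (nat \<Rightarrow> real mat) \<Rightarrow> real mat" where
  "block_V_mat M \<tau> p V =
     (1 / frob_norm M) \<cdot>\<^sub>m
       mat_of_cols (dim_col M)
         (concat (map (\<lambda>i. cols (frob_norm (row_block M (\<tau> i)) \<cdot>\<^sub>m
                                  leading_cols (mat_rank (row_block M (\<tau> i))) (V i)))
                      [1..<Suc p]))"

text \<open>The RBK iterates along a sequence \<open>\<iota> 1, \<iota> 2, \<dots>\<close> of block indices.\<close>

primrec rbk ::
    "real mat \<Rightarrow> real vec \<Rightarrow> (nat \<Rightarrow> nat set) \<Rightarrow> real vec \<Rightarrow> (nat \<Rightarrow> nat) \<Rightarrow> nat \<Rightarrow> real vec" where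
  "rbk M c \<tau> x0 \<iota> 0 = x0"
| "rbk M c \<tau> x0 \<iota> (Suc k) =
     (let x = rbk M c \<tau> x0 \<iota> k; I = \<tau> (\<iota> (Suc k))
      in x + pinv (row_block M I) *\<^sub>v (subvec c I - row_block M I *\<^sub>v x))"

text \<open>Independent block indices \<open>\<iota> 1, \<iota> 2, \<dots>\<close> on the probability space
  \<open>P\<close>, drawn with probability proportional to the squared Frobenius norm of the block.\<close>

definition rbk_sampling ::
    "'w measure \<Rightarrow> real mat \<Rightarrow> (nat \<Rightarrow> nat set) \<Rightarrow> nat \<Rightarrow> (nat \<Rightarrow> 'w \<Rightarrow> nat) \<Rightarrow> bool" where
  "rbk_sampling P M \<tau> p \<iota> \<longleftrightarrow>
     prob_space P \<and>
     prob_space.indep_vars P (\<lambda>_. count_space {1..p}) \<iota> {1..} \<and>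
     (\<forall>k\<ge>1. \<forall>i\<in>{1..p}.
        measure P {\<omega> \<in> space P. \<iota> k \<omega> = i} = (frob_norm (row_block M (\<tau> i)))\<^sup>2 / (frob_norm M)\<^sup>2)"

definition vec_expectation :: "'w measure \<Rightarrow> nat \<Rightarrow> ('w \<Rightarrow> real vec) \<Rightarrow> real vec" where
  "vec_expectation P n X = vec n (\<lambda>j. \<integral>\<omega>. X \<omega> $ j \<partial>P)"

end

theory Submission
  imports Defs
begin

text \<open>
  Averaging turns the random iteration into a deterministic affine one. Let \<open>D\<^sub>i\<close> be
  the \<open>i\<close>-th row block, \<open>q\<^sub>i\<close> its probability,
  \<open>Q\<^sub>i = pinv D\<^sub>i * D\<^sub>i\<close> the orthogonal projector onto its row space and
  \<open>z\<^sub>i\<close> the least-squares solution of its subsystem. As \<open>z\<^sub>i\<close> lies in that row space,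
  a step with block \<open>i\<close> is \<open>x \<mapsto> (I - Q\<^sub>i) x + Q\<^sub>i z\<^sub>i\<close>. This is affine in
  \<open>x\<close>, and the block is drawn independently of the past; hence the mean error
  \<open>e\<^sub>k = E(x\<^sub>k) - x_LS\<close> satisfies
  \<open>e\<^sub>k\<^sub>+\<^sub>1 = (I - B) e\<^sub>k + drift\<close> with \<open>B = \<Sum>\<^sub>i q\<^sub>i Q\<^sub>i\<close> and
  \<open>drift = \<Sum>\<^sub>i q\<^sub>i Q\<^sub>i (z\<^sub>i - x_LS)\<close> (\<open>vec_expectation_rbk_Suc\<close>).

  The factor \<open>I - B\<close> shrinks norms by \<open>1 - \<eta>\<close>. A positive least eigenvalue of
  \<open>D\<^sub>i D\<^sub>i\<^sup>T\<close> forces \<open>D\<^sub>i\<close> to have full row rank, and then the leading right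
  singular vectors form an orthonormal basis of its row space, so that
  \<open>Q\<^sub>i = V\<^sub>r V\<^sub>r\<^sup>T\<close> (\<open>proj_eq_leading_cols_gram\<close>). Consequently \<open>B\<close> is the Gram
  matrix whose least eigenvalue is \<open>\<eta>\<close>. An average of projectors satisfies
  \<open>0 \<le> B \<le> I\<close>, so \<open>I - B\<close> is positive semidefinite with quadratic form at most
  \<open>1 - \<eta>\<close>, and for a symmetric positive semidefinite matrix the same number bounds the
  norm (\<open>symmetric_contraction\<close>). The full row rank of the concatenated matrix gives
  \<open>\<eta> > 0\<close>.

  The norm of \<open>drift\<close> is at most the average of the norms of its summands. With \<open>x\<close> the
  least-squares solution of the noisy system,
  \<open>Q\<^sub>i (z\<^sub>i - x_LS) = Q\<^sub>i (z\<^sub>i - x) + Q\<^sub>i (x - x_LS)\<close>. The second part is at most the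
  norm of \<open>x - x_LS\<close>. The first is the cosine of the angle to the row space times
  the norm of \<open>x - z\<^sub>i = (I - Q\<^sub>i) x - pinv D\<^sub>i (c\<^sub>i - D\<^sub>i x)\<close>, where \<open>c\<^sub>i\<close> is the block of
  the right-hand side; there the projection of \<open>x\<close> is no longer than \<open>x\<close>, the block
  residual is a subvector of the full residual, and \<open>pinv D\<^sub>i\<close> has norm at most
  \<open>1 / sqrt \<alpha>\<^sub>1\<close> (\<open>block_error_bound\<close>). Unrolling the recursion and summing the geometric
  series yields the factor \<open>1 / \<eta>\<close> (\<open>affine_recursion_bound\<close>).
\<close>

section \<open>Euclidean norm and positive semidefinite forms\<close>

lemma vnorm_L2_set: "vnorm v = L2_set (($) v) {..<dim_vec v}"
  by (simp add: vnorm_def L2_set_def scalar_prod_def lessThan_atLeast0 power2_eq_square)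

lemma vnorm_nonneg [simp]: "0 \<le> vnorm v"
  by (simp add: vnorm_L2_set)

lemma vnorm_power2: "(vnorm v)\<^sup>2 = v \<bullet> v"
  by (simp add: vnorm_L2_set L2_set_def sum_nonneg scalar_prod_def lessThan_atLeast0 power2_eq_square)

lemma scalar_prod_self_nonneg [simp]: "0 \<le> v \<bullet> (v :: real vec)"
  by (metis vnorm_power2 zero_le_power2)

lemma vnorm_eq_0_iff: "v \<in> carrier_vec n \<Longrightarrow> vnorm v = 0 \<longleftrightarrow> v = 0\<^sub>v n"
  by (auto simp: vnorm_L2_set L2_set_eq_0_iff)

lemma scalar_prod_self_eq_0_iff: "v \<in> carrier_vec n \<Longrightarrow> v \<bullet> v = 0 \<longleftrightarrow> v = 0\<^sub>v n" for v :: "real vec"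
  by (metis vnorm_eq_0_iff vnorm_power2 zero_eq_power2)

lemma vnorm_add_le:
  assumes "u \<in> carrier_vec n" "v \<in> carrier_vec n"
  shows "vnorm (u + v) \<le> vnorm u + vnorm v"
proof -
  have "vnorm (u + v) = L2_set (\<lambda>i. u $ i + v $ i) {..<n}"
    unfolding vnorm_L2_set using assms by (intro L2_set_cong) auto
  then show ?thesis using L2_set_triangle_ineq[of "($) u" "($) v" "{..<n}"] assms
    by (simp add: vnorm_L2_set)
qed

lemma vnorm_smult: "vnorm (c \<cdot>\<^sub>v v) = \<bar>c\<bar> * vnorm v"
proof -
  have "vnorm (c \<cdot>\<^sub>v v) = L2_set (\<lambda>i. \<bar>c\<bar> * v $ i) {..<dim_vec v}"
    unfolding vnorm_L2_set L2_set_def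
    by (simp add: power_mult_distrib)
  then show ?thesis by (simp add: vnorm_L2_set L2_set_right_distrib)
qed

lemma vnorm_minus_commute:
  assumes "u \<in> carrier_vec n" "v \<in> carrier_vec n"
  shows "vnorm (u - v) = vnorm (v - u)"
proof -
  have "u - v = (-1) \<cdot>\<^sub>v (v - u)" using assms by (intro eq_vecI) auto
  then show ?thesis by (simp add: vnorm_smult)
qed

lemma cauchy_schwarz_vec:
  assumes "u \<in> carrier_vec n" "v \<in> carrier_vec n"
  shows "\<bar>u \<bullet> v\<bar> \<le> vnorm u * vnorm v"
proof -
  have "\<bar>u \<bullet> v\<bar> \<le> (\<Sum>i<n. \<bar>u $ i\<bar> * \<bar>v $ i\<bar>)"
    using assms by (auto simp: scalar_prod_def lessThan_atLeast0 abs_mult[symmetric] intro: sum_abs)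
  then show ?thesis using L2_set_mult_ineq[of "($) u" "($) v" "{..<n}"] assms
    by (simp add: vnorm_L2_set)
qed

lemma quadratic_nonneg_imp_discriminant:
  fixes a b c :: real
  assumes nn: "\<And>t. 0 \<le> a + 2 * b * t + c * t\<^sup>2" and c: "0 \<le> c"
  shows "b\<^sup>2 \<le> a * c"
proof (cases "c = 0")
  case True
  have "b = 0"
  proof (rule ccontr)
    assume "b \<noteq> 0"
    \<comment> \<open>at this \<open>t\<close> the remaining linear polynomial has the value \<open>-1\<close>\<close>
    then show False using nn[of "-(a+1)/(2*b)"] True by (simp add: field_simps)
  qed
  then show ?thesis using True by simp
next
  case False
  then show ?thesis using nn[of "-b/c"] c
    by (simp add: field_simps power2_eq_square)
qed

definition pos_semidef :: "nat \<Rightarrow> real mat \<Rightarrow> bool" where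
  "pos_semidef n Q \<longleftrightarrow> Q \<in> carrier_mat n n \<and> Q\<^sup>T = Q \<and> (\<forall>x\<in>carrier_vec n. 0 \<le> x \<bullet> (Q *\<^sub>v x))"

lemma symmetric_scalar_prod:
  fixes Q :: "real mat"
  assumes "Q \<in> carrier_mat n n" "Q\<^sup>T = Q" "x \<in> carrier_vec n" "y \<in> carrier_vec n"
  shows "x \<bullet> (Q *\<^sub>v y) = y \<bullet> (Q *\<^sub>v x)"
  using transpose_vec_mult_scalar[OF assms(1) assms(4) assms(3)] assms
  by (metis comm_scalar_prod mult_mat_vec_carrier)

text \<open>
  The form is nonnegative along every line \<open>x + t y\<close>, so the discriminant of this
  quadratic polynomial in \<open>t\<close> is not positive.
\<close>

lemma psd_cauchy_schwarz:
  assumes Q: "pos_semidef n Q" and x: "x \<in> carrier_vec n" and y: "y \<in> carrier_vec n"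
  shows "(x \<bullet> (Q *\<^sub>v y))\<^sup>2 \<le> (x \<bullet> (Q *\<^sub>v x)) * (y \<bullet> (Q *\<^sub>v y))"
proof (rule quadratic_nonneg_imp_discriminant)
  have Qc: "Q \<in> carrier_mat n n" and Qs: "Q\<^sup>T = Q" using Q by (auto simp: pos_semidef_def)
  show "0 \<le> y \<bullet> (Q *\<^sub>v y)" using Q y by (simp add: pos_semidef_def)
  fix t :: real
  have ty: "t \<cdot>\<^sub>v y \<in> carrier_vec n" using y by simp
  have Qx: "Q *\<^sub>v x \<in> carrier_vec n" "Q *\<^sub>v y \<in> carrier_vec n" using Qc x y by auto
  have "0 \<le> (x + t \<cdot>\<^sub>v y) \<bullet> (Q *\<^sub>v (x + t \<cdot>\<^sub>v y))" using Q x y by (simp add: pos_semidef_def)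
  also have "Q *\<^sub>v (x + t \<cdot>\<^sub>v y) = Q *\<^sub>v x + t \<cdot>\<^sub>v (Q *\<^sub>v y)"
    using mult_add_distrib_mat_vec[OF Qc x ty] mult_mat_vec[OF Qc y] by simp
  also have "(x + t \<cdot>\<^sub>v y) \<bullet> \<dots> = x \<bullet> (Q *\<^sub>v x) + t * (x \<bullet> (Q *\<^sub>v y)) + (t * (y \<bullet> (Q *\<^sub>v x)) + t * (t * (y \<bullet> (Q *\<^sub>v y))))"
    using x y Qx ty by (simp add: add_scalar_prod_distrib[of _ n] scalar_prod_add_distrib[of _ n])
  also have "y \<bullet> (Q *\<^sub>v x) = x \<bullet> (Q *\<^sub>v y)" by (rule symmetric_scalar_prod[OF Qc Qs y x])
  finally show "0 \<le> x \<bullet> (Q *\<^sub>v x) + 2 * (x \<bullet> (Q *\<^sub>v y)) * t + y \<bullet> (Q *\<^sub>v y) * t\<^sup>2"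
    by (simp add: algebra_simps power2_eq_square)
qed

text \<open>
  Cauchy-Schwarz for the form, applied to \<open>x\<close> and \<open>Q x\<close>, bounds the fourth power of the
  norm of \<open>Q x\<close> by the form at \<open>x\<close> times the form at \<open>Q x\<close>; the hypothesis bounds the
  latter. The inequality serves two ends: it turns a bound on the form into a bound on the
  operator norm, and it bounds a nonsingular form away from \<open>0\<close> on unit vectors.
\<close>

lemma psd_image_bound:
  assumes Q: "pos_semidef n Q" and x: "x \<in> carrier_vec n"
    and c: "\<And>z. z \<in> carrier_vec n \<Longrightarrow> z \<bullet> (Q *\<^sub>v z) \<le> c * (z \<bullet> z)"
  shows "(Q *\<^sub>v x) \<bullet> (Q *\<^sub>v x) \<le> c * (x \<bullet> (Q *\<^sub>v x))"
proof -
  have Qc: "Q \<in> carrier_mat n n" and Qs: "Q\<^sup>T = Q" using Q by (auto simp: pos_semidef_def)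
  define y where "y = Q *\<^sub>v x"
  have y: "y \<in> carrier_vec n" using Qc x by (simp add: y_def)
  have xQ: "0 \<le> x \<bullet> (Q *\<^sub>v x)" using Q x by (simp add: pos_semidef_def)
  have "(y \<bullet> y)\<^sup>2 = (x \<bullet> (Q *\<^sub>v y))\<^sup>2"
    using symmetric_scalar_prod[OF Qc Qs x y] by (simp add: y_def)
  also have "\<dots> \<le> (x \<bullet> (Q *\<^sub>v x)) * (y \<bullet> (Q *\<^sub>v y))" by (rule psd_cauchy_schwarz[OF Q x y])
  also have "\<dots> \<le> (x \<bullet> (Q *\<^sub>v x)) * (c * (y \<bullet> y))" using c[OF y] xQ by (rule mult_left_mono)
  finally have *: "(y \<bullet> y) * (y \<bullet> y) \<le> (c * (x \<bullet> (Q *\<^sub>v x))) * (y \<bullet> y)"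
    by (simp add: power2_eq_square algebra_simps)
  show ?thesis
  proof (cases "y \<bullet> y = 0")
    case True
    have "0 \<le> c * (x \<bullet> (Q *\<^sub>v x))"
    proof (cases "x = 0\<^sub>v n")
      case False
      then have "0 < x \<bullet> x" using scalar_prod_self_eq_0_iff[OF x] scalar_prod_self_nonneg[of x] by linarith
      moreover have "0 \<le> c * (x \<bullet> x)" using c[OF x] xQ by linarith
      ultimately have "0 \<le> c" by (simp add: zero_le_mult_iff)
      then show ?thesis using xQ by simp
    qed (use Qc in simp)
    then show ?thesis using True by (simp add: y_def)
  next
    case False
    then have "0 < y \<bullet> y" using scalar_prod_self_nonneg[of y] by linarith
    with * show ?thesis by (simp add: y_def)
  qed
qed

lemma mult_mat_vec_vnorm_bound:
  assumes M: "M \<in> carrier_mat m n" and x: "x \<in> carrier_vec n"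
  shows "vnorm (M *\<^sub>v x) \<le> frob_norm M * vnorm x"
proof -
  have "(\<Sum>i<m. (row M i \<bullet> x)\<^sup>2) \<le> (\<Sum>i<m. (row M i \<bullet> row M i) * (x \<bullet> x))"
  proof (rule sum_mono)
    fix i assume "i \<in> {..<m}"
    then have "row M i \<in> carrier_vec n" using M by auto
    from power_mono[OF cauchy_schwarz_vec[OF this x], of 2]
    show "(row M i \<bullet> x)\<^sup>2 \<le> (row M i \<bullet> row M i) * (x \<bullet> x)"
      by (simp add: power_mult_distrib vnorm_power2)
  qed
  also have "\<dots> = (frob_norm M)\<^sup>2 * (x \<bullet> x)"
    using M by (simp add: sum_distrib_right[symmetric] frob_norm_def sum_nonneg scalar_prod_def
        lessThan_atLeast0 power2_eq_square)
  also have "(\<Sum>i<m. (row M i \<bullet> x)\<^sup>2) = (vnorm (M *\<^sub>v x))\<^sup>2"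
    unfolding vnorm_power2 using M
    by (simp add: scalar_prod_def[of "M *\<^sub>v x"] lessThan_atLeast0 power2_eq_square)
  finally have "(vnorm (M *\<^sub>v x))\<^sup>2 \<le> (frob_norm M * vnorm x)\<^sup>2"
    by (simp add: power_mult_distrib vnorm_power2)
  moreover have "0 \<le> frob_norm M * vnorm x" by (simp add: frob_norm_def sum_nonneg)
  ultimately show ?thesis by (rule power2_le_imp_le)
qed

section \<open>The least eigenvalue of a symmetric matrix\<close>

lemma square_inverse_if_trivial_kernel:
  fixes M :: "'a :: field mat"
  assumes M: "M \<in> carrier_mat n n"
    and ker: "\<And>x. x \<in> carrier_vec n \<Longrightarrow> M *\<^sub>v x = 0\<^sub>v n \<Longrightarrow> x = 0\<^sub>v n"
  obtains G where "G \<in> carrier_mat n n" "G * M = 1\<^sub>m n" "M * G = 1\<^sub>m n"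
proof -
  have "Determinant.det M \<noteq> 0" using det_0_iff_vec_prod_zero_field[OF M] ker by blast
  from det_non_zero_imp_unit[OF M this, of "()"] that show thesis
    unfolding Units_def ring_mat_def by auto
qed

text \<open>
  Let \<open>\<mu>\<close> be the infimum of the Rayleigh quotient, so that \<open>Q = N - \<mu> I\<close> is positive
  semidefinite. If \<open>Q\<close> had an inverse \<open>G\<close>, then for unit vectors \<open>x\<close> the norm of \<open>Q x\<close>
  would be bounded below, and \<open>psd_image_bound\<close> would bound the form of \<open>Q\<close> below by a
  positive constant, contradicting the choice of \<open>\<mu>\<close>. Thus \<open>Q\<close> is singular and \<open>\<mu>\<close> is an
  eigenvalue.
\<close>

lemma rayleigh_min_attained:
  fixes N :: "real mat"
  assumes N: "N \<in> carrier_mat n n" and sym: "N\<^sup>T = N" and n: "0 < n"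
  obtains \<mu> v where "v \<in> carrier_vec n" "v \<noteq> 0\<^sub>v n" "N *\<^sub>v v = \<mu> \<cdot>\<^sub>v v"
    "\<And>x. x \<in> carrier_vec n \<Longrightarrow> \<mu> * (x \<bullet> x) \<le> x \<bullet> (N *\<^sub>v x)"
proof -
  define R where "R = (\<lambda>x. x \<bullet> (N *\<^sub>v x)) ` {x \<in> carrier_vec n. x \<bullet> x = 1}"
  define \<mu> where "\<mu> = Inf R"
  define C where "C = frob_norm N"
  have form_bound: "\<bar>x \<bullet> (N *\<^sub>v x)\<bar> \<le> C * (x \<bullet> x)" if x: "x \<in> carrier_vec n" for x
  proof -
    have "\<bar>x \<bullet> (N *\<^sub>v x)\<bar> \<le> vnorm x * vnorm (N *\<^sub>v x)"
      using N x by (intro cauchy_schwarz_vec) auto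
    also have "\<dots> \<le> vnorm x * (C * vnorm x)"
      unfolding C_def using mult_mat_vec_vnorm_bound[OF N x] by (intro mult_left_mono) auto
    also have "\<dots> = C * (x \<bullet> x)" by (simp add: vnorm_power2[symmetric] power2_eq_square)
    finally show ?thesis .
  qed
  have bdd: "bdd_below R" unfolding R_def
  proof (rule bdd_belowI2)
    fix x :: "real vec" assume "x \<in> {x \<in> carrier_vec n. x \<bullet> x = 1}"
    then show "- C \<le> x \<bullet> (N *\<^sub>v x)" using form_bound[of x] by auto
  qed
  have ne: "R \<noteq> {}"
  proof -
    have "unit_vec n 0 \<in> {x \<in> carrier_vec n. x \<bullet> (x::real vec) = 1}" using n by simp
    then show ?thesis unfolding R_def by blast
  qed
  have \<mu>_le: "\<mu> * (x \<bullet> x) \<le> x \<bullet> (N *\<^sub>v x)" if x: "x \<in> carrier_vec n" for x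
  proof (cases "x = 0\<^sub>v n")
    case False
    then have pos: "0 < x \<bullet> x" using scalar_prod_self_eq_0_iff[OF x] scalar_prod_self_nonneg[of x] by linarith
    define s where "s = 1 / vnorm x"
    have s2: "s * s * (x \<bullet> x) = 1" using pos by (simp add: s_def vnorm_def)
    have "s * s * (x \<bullet> (N *\<^sub>v x)) \<in> R" unfolding R_def
    proof (rule image_eqI[where x = "s \<cdot>\<^sub>v x"])
      show "s * s * (x \<bullet> (N *\<^sub>v x)) = (s \<cdot>\<^sub>v x) \<bullet> (N *\<^sub>v (s \<cdot>\<^sub>v x))"
        using N x by (simp add: mult_mat_vec[OF N x])
    qed (use x s2 in \<open>simp add: mult.assoc\<close>)
    then have "\<mu> \<le> s * s * (x \<bullet> (N *\<^sub>v x))" unfolding \<mu>_def using bdd by (rule cInf_lower)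
    then have "\<mu> * (x \<bullet> x) \<le> s * s * (x \<bullet> (N *\<^sub>v x)) * (x \<bullet> x)" using pos by (intro mult_right_mono) auto
    also have "\<dots> = (s * s * (x \<bullet> x)) * (x \<bullet> (N *\<^sub>v x))" by (simp only: ac_simps)
    finally show ?thesis using s2 by simp
  qed (use N in simp)
  define Q where "Q = N - \<mu> \<cdot>\<^sub>m 1\<^sub>m n"
  have Qc: "Q \<in> carrier_mat n n" by (auto simp: Q_def intro!: minus_carrier_mat)
  have Qx: "Q *\<^sub>v x = N *\<^sub>v x - \<mu> \<cdot>\<^sub>v x" if x: "x \<in> carrier_vec n" for x
    unfolding Q_def using N x
    by (intro eq_vecI) (auto simp: minus_scalar_prod_distrib[of _ n] minus_mult_distrib_mat_vec[OF N])
  have Qform: "x \<bullet> (Q *\<^sub>v x) = x \<bullet> (N *\<^sub>v x) - \<mu> * (x \<bullet> x)" if x: "x \<in> carrier_vec n" for x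
    using N x by (simp add: Qx scalar_prod_minus_distrib[of _ n])
  have psd: "pos_semidef n Q" unfolding pos_semidef_def
  proof (intro conjI ballI)
    show "Q\<^sup>T = Q"
    proof (rule eq_matI)
      fix i j assume "i < dim_row Q" "j < dim_col Q"
      then have ij: "i < n" "j < n" using Qc by auto
      then have "N $$ (j, i) = N $$ (i, j)" using N sym by (metis carrier_matD index_transpose_mat(1))
      then show "Q\<^sup>T $$ (i, j) = Q $$ (i, j)" using ij N by (simp add: Q_def)
    qed (use Qc in auto)
  qed (use Qc Qform \<mu>_le in auto)
  have "\<exists>v\<in>carrier_vec n. v \<noteq> 0\<^sub>v n \<and> Q *\<^sub>v v = 0\<^sub>v n"
  proof (rule ccontr)
    assume "\<not> ?thesis"
    then obtain G where G: "G \<in> carrier_mat n n" "G * Q = 1\<^sub>m n"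
      using square_inverse_if_trivial_kernel[OF Qc] by metis
    define c where "c = C + \<bar>\<mu>\<bar> + 1"
    \<comment> \<open>adding \<open>1\<close> only ensures that \<open>K\<close> is positive\<close>
    define K where "K = (frob_norm G)\<^sup>2 * c + 1"
    have C0: "0 \<le> C" by (simp add: C_def frob_norm_def sum_nonneg)
    then have c0: "0 < c" by (simp add: c_def add_nonneg_pos)
    have c: "z \<bullet> (Q *\<^sub>v z) \<le> c * (z \<bullet> z)" if z: "z \<in> carrier_vec n" for z
    proof -
      have "- \<mu> * (z \<bullet> z) \<le> \<bar>\<mu>\<bar> * (z \<bullet> z)" by (intro mult_right_mono) auto
      then have "z \<bullet> (Q *\<^sub>v z) \<le> (C + \<bar>\<mu>\<bar>) * (z \<bullet> z)"
        using form_bound[OF z] Qform[OF z] by (simp add: algebra_simps)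
      also have "\<dots> \<le> c * (z \<bullet> z)" by (intro mult_right_mono) (auto simp: c_def)
      finally show ?thesis .
    qed
    have K0: "0 < K" unfolding K_def using c0 by (intro add_nonneg_pos) auto
    have lower: "1 / K \<le> r - \<mu>" if "r \<in> R" for r
    proof -
      from that obtain x where x: "x \<in> carrier_vec n" "x \<bullet> x = 1" and r: "r = x \<bullet> (N *\<^sub>v x)"
        by (auto simp: R_def)
      have Qxc: "Q *\<^sub>v x \<in> carrier_vec n" using Qc x by simp
      have "x = G *\<^sub>v (Q *\<^sub>v x)" using assoc_mult_mat_vec[OF G(1) Qc x(1)] G x by simp
      then have "vnorm x \<le> frob_norm G * vnorm (Q *\<^sub>v x)"
        using mult_mat_vec_vnorm_bound[OF G(1) Qxc] by simp
      then have "(vnorm x)\<^sup>2 \<le> (frob_norm G * vnorm (Q *\<^sub>v x))\<^sup>2" by (rule power_mono) simp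
      then have "1 \<le> (frob_norm G)\<^sup>2 * ((Q *\<^sub>v x) \<bullet> (Q *\<^sub>v x))"
        by (simp add: vnorm_power2 x power_mult_distrib)
      also have "\<dots> \<le> (frob_norm G)\<^sup>2 * (c * (x \<bullet> (Q *\<^sub>v x)))"
        using psd_image_bound[OF psd x(1) c] by (intro mult_left_mono) auto
      also have "\<dots> \<le> K * (x \<bullet> (Q *\<^sub>v x))"
        using psd x by (simp add: K_def pos_semidef_def algebra_simps)
      also have "x \<bullet> (Q *\<^sub>v x) = r - \<mu>" using Qform x r by simp
      finally show ?thesis using K0 by (simp add: field_simps)
    qed
    have "\<mu> + 1 / K \<le> Inf R" using ne lower by (intro cInf_greatest) (auto simp: algebra_simps)
    then show False using K0 by (simp add: \<mu>_def)
  qed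
  then obtain v where v: "v \<in> carrier_vec n" "v \<noteq> 0\<^sub>v n" "Q *\<^sub>v v = 0\<^sub>v n" by blast
  have "N *\<^sub>v v = \<mu> \<cdot>\<^sub>v v"
  proof (rule eq_vecI)
    fix i assume "i < dim_vec (\<mu> \<cdot>\<^sub>v v)"
    then have i: "i < n" using v by simp
    have "(N *\<^sub>v v - \<mu> \<cdot>\<^sub>v v) $ i = 0" unfolding Qx[OF v(1), symmetric] v(3) using i by simp
    then show "(N *\<^sub>v v) $ i = (\<mu> \<cdot>\<^sub>v v) $ i" using i N v(1) by simp
  qed (use N v in auto)
  then show thesis using that v \<mu>_le by blast
qed

lemma
  fixes N :: "real mat"
  assumes N: "N \<in> carrier_mat n n" and sym: "N\<^sup>T = N" and n: "0 < n"
  shows lambda_min_le_form: "x \<in> carrier_vec n \<Longrightarrow> lambda_min N * (x \<bullet> x) \<le> x \<bullet> (N *\<^sub>v x)"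
    and lambda_min_eigenvector:
      "\<exists>v\<in>carrier_vec n. v \<noteq> 0\<^sub>v n \<and> N *\<^sub>v v = lambda_min N \<cdot>\<^sub>v v"
proof -
  obtain \<mu> v where v: "v \<in> carrier_vec n" "v \<noteq> 0\<^sub>v n" "N *\<^sub>v v = \<mu> \<cdot>\<^sub>v v"
    and \<mu>: "\<And>x. x \<in> carrier_vec n \<Longrightarrow> \<mu> * (x \<bullet> x) \<le> x \<bullet> (N *\<^sub>v x)"
    using rayleigh_min_attained[OF N sym n] by blast
  have "Min (spectrum N) = \<mu>"
  proof (rule Min_eqI)
    show "finite (spectrum N)" by (rule card_finite_spectrum[OF N])
    show "\<mu> \<in> spectrum N" using v N by (auto simp: spectrum_def eigenvalue_def eigenvector_def)
    fix l assume "l \<in> spectrum N"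
    then obtain w where w: "w \<in> carrier_vec n" "w \<noteq> 0\<^sub>v n" "N *\<^sub>v w = l \<cdot>\<^sub>v w"
      using N by (auto simp: spectrum_def eigenvalue_def eigenvector_def)
    have "0 < w \<bullet> w" using scalar_prod_self_eq_0_iff[OF w(1)] w(2) scalar_prod_self_nonneg[of w] by linarith
    then show "\<mu> \<le> l" using \<mu>[OF w(1)] w by simp
  qed
  then have "lambda_min N = \<mu>" by (simp add: lambda_min_def)
  then show "x \<in> carrier_vec n \<Longrightarrow> lambda_min N * (x \<bullet> x) \<le> x \<bullet> (N *\<^sub>v x)"
    and "\<exists>v\<in>carrier_vec n. v \<noteq> 0\<^sub>v n \<and> N *\<^sub>v v = lambda_min N \<cdot>\<^sub>v v" using v \<mu> by auto
qed

section \<open>Existence and uniqueness of the Moore-Penrose inverse\<close>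

text \<open>
  Wedderburn's rank reduction: for an entry \<open>a = M (i, j) \<noteq> 0\<close> let \<open>E\<close> have the single
  nonzero entry \<open>1 / a\<close> at \<open>(j, i)\<close>. Then \<open>M' = M - M E M\<close> has a zero \<open>i\<close>-th row and keeps the
  zero rows of \<open>M\<close>, and a generalised inverse \<open>G'\<close> of \<open>M'\<close> yields
  \<open>E + (I - E M) G' (I - M E)\<close> for \<open>M\<close>.
\<close>

lemma g_inverse_exists:
  fixes M :: "real mat"
  assumes "M \<in> carrier_mat m n"
  shows "\<exists>G\<in>carrier_mat n m. M * G * M = M"
  using assms
proof (induction "card {k. k < m \<and> row M k \<noteq> 0\<^sub>v n}" arbitrary: M rule: less_induct)
  case (less M)
  note M = less.prems
  show ?case
  proof (cases "M = 0\<^sub>m m n")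
    case True
    then show ?thesis by (intro bexI[of _ "0\<^sub>m n m"]) auto
  next
    case False
    then obtain i j where ij: "i < m" "j < n" and a: "M $$ (i, j) \<noteq> 0"
      using eq_matI[of M "0\<^sub>m m n"] M by fastforce
    define a where "a = M $$ (i, j)"
    define E where "E = mat n m (\<lambda>(s, t). if s = j \<and> t = i then 1 / a else 0)"
    define L where "L = 1\<^sub>m m - M * E"
    define R where "R = 1\<^sub>m n - E * M"
    define M' where "M' = L * M"
    have E: "E \<in> carrier_mat n m" by (simp add: E_def)
    have L: "L \<in> carrier_mat m m" and R: "R \<in> carrier_mat n n"
      using M E by (auto simp: L_def R_def)
    have M': "M' \<in> carrier_mat m n" using L M by (simp add: M'_def)
    have ME: "M * E \<in> carrier_mat m m" and EM: "E * M \<in> carrier_mat n n" using M E by auto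
    have M'_L: "M' = M - M * E * M"
      unfolding M'_def L_def using minus_mult_distrib_mat[OF one_carrier_mat ME M] M by simp
    have M'_R: "M' = M * R"
      unfolding M'_L R_def using mult_minus_distrib_mat[OF M one_carrier_mat EM]
        assoc_mult_mat[OF M E M] M by simp
    have ME_entry: "(M * E) $$ (k, t) = (if t = i then M $$ (k, j) / a else 0)"
      if "k < m" "t < m" for k t
    proof -
      have "(M * E) $$ (k, t) = (\<Sum>s<n. M $$ (k, s) * (if s = j \<and> t = i then 1 / a else 0))"
        using that M E by (simp add: scalar_prod_def E_def lessThan_atLeast0)
      also have "\<dots> = (\<Sum>s<n. if s = j then (if t = i then M $$ (k, j) / a else 0) else 0)"
        by (intro sum.cong) auto
      finally show ?thesis using ij by simp
    qed
    have MEM_entry: "(M * E * M) $$ (k, c) = M $$ (k, j) / a * M $$ (i, c)" if "k < m" "c < n" for k c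
    proof -
      have "(M * E * M) $$ (k, c) = (\<Sum>t<m. (M * E) $$ (k, t) * M $$ (t, c))"
        using that M ME
        by (subst index_mult_mat(1)) (auto simp: scalar_prod_def lessThan_atLeast0 simp del: index_mult_mat(1))
      also have "\<dots> = (\<Sum>t<m. if t = i then M $$ (k, j) / a * M $$ (i, c) else 0)"
        using that by (intro sum.cong) (auto simp: ME_entry)
      finally show ?thesis using ij by simp
    qed
    have M'_entry: "M' $$ (k, c) = M $$ (k, c) - M $$ (k, j) / a * M $$ (i, c)" if "k < m" "c < n" for k c
      unfolding M'_L using that M E MEM_entry[OF that]
      by (subst index_minus_mat) (auto simp del: index_mult_mat(1))
    have "{k. k < m \<and> row M' k \<noteq> 0\<^sub>v n} \<subset> {k. k < m \<and> row M k \<noteq> 0\<^sub>v n}"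
    proof (intro psubsetI subsetI)
      fix k assume "k \<in> {k. k < m \<and> row M' k \<noteq> 0\<^sub>v n}"
      then have k: "k < m" and ne: "row M' k \<noteq> 0\<^sub>v n" by auto
      have "row M k \<noteq> 0\<^sub>v n"
      proof
        assume "row M k = 0\<^sub>v n"
        then have "M $$ (k, c) = 0" if "c < n" for c
          using that k M by (metis carrier_matD index_row(1) index_zero_vec(1))
        then have "row M' k = 0\<^sub>v n" using M' k ij by (intro eq_vecI) (auto simp: M'_entry)
        with ne show False by simp
      qed
      then show "k \<in> {k. k < m \<and> row M k \<noteq> 0\<^sub>v n}" using k by simp
    next
      have "row M' i = 0\<^sub>v n"
        using M' ij a by (intro eq_vecI) (auto simp: M'_entry a_def)
      moreover have "row M i \<noteq> 0\<^sub>v n"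
        using a ij M by (metis carrier_matD index_row(1) index_zero_vec(1))
      ultimately show "{k. k < m \<and> row M' k \<noteq> 0\<^sub>v n} \<noteq> {k. k < m \<and> row M k \<noteq> 0\<^sub>v n}"
        using ij by blast
    qed
    then have "card {k. k < m \<and> row M' k \<noteq> 0\<^sub>v n} < card {k. k < m \<and> row M k \<noteq> 0\<^sub>v n}"
      by (intro psubset_card_mono) auto
    from less.hyps[OF this M'] obtain G' where G': "G' \<in> carrier_mat n m" and M'G: "M' * G' * M' = M'"
      by blast
    define G where "G = E + R * G' * L"
    have RG: "R * G' \<in> carrier_mat n m" "R * G' * L \<in> carrier_mat n m" using R G' L by auto
    have "M * G * M = M * E * M + M * (R * G' * L) * M"
      unfolding G_def using M E RG
      by (simp add: mult_add_distrib_mat[OF M E RG(2)] add_mult_distrib_mat[OF ME _ M])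
    also have "M * (R * G' * L) * M = (M * R) * G' * (L * M)"
      using M R G' L by (simp add: assoc_mult_mat[of _ m n _ n _ m] assoc_mult_mat[of _ n n _ m _ n]
          assoc_mult_mat[of _ m n _ m _ n] assoc_mult_mat[of _ m n _ n _ n]
          assoc_mult_mat[of _ n m _ m _ n] assoc_mult_mat[of _ n n _ m _ m]
          assoc_mult_mat[of _ m n _ m _ m] assoc_mult_mat[of _ m m _ m _ n])
    also have "\<dots> = M'" using M'G M'_R M'_def by simp
    also have "M * E * M + M' = M"
      unfolding M'_L using M E by (intro eq_matI) auto
    finally show ?thesis using E RG by (intro bexI[of _ G]) (auto simp: G_def)
  qed
qed

lemma minus_mat_eq_0_imp:
  fixes A B :: "'a :: ab_group_add mat"
  assumes A: "A \<in> carrier_mat m n" and B: "B \<in> carrier_mat m n" and 0: "A - B = 0\<^sub>m m n"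
  shows "A = B"
proof (rule eq_matI)
  fix i j assume "i < dim_row B" "j < dim_col B"
  then have ij: "i < m" "j < n" using B by auto
  then have "(A - B) $$ (i, j) = 0" by (simp add: 0)
  then show "A $$ (i, j) = B $$ (i, j)" using ij A B by simp
qed (use A B in auto)

text \<open>
  If \<open>M\<^sup>T M d = 0\<close>, then the squared norm of \<open>M d\<close> is \<open>0\<close>; this is applied to each
  column \<open>d\<close> of \<open>D\<close>.
\<close>

lemma gram_mult_eq_0_imp:
  fixes M :: "real mat"
  assumes M: "M \<in> carrier_mat m n" and D: "D \<in> carrier_mat n k" and 0: "M\<^sup>T * (M * D) = 0\<^sub>m n k"
  shows "M * D = 0\<^sub>m m k"
proof (rule eq_matI)
  fix i j assume "i < dim_row (0\<^sub>m m k :: real mat)" "j < dim_col (0\<^sub>m m k :: real mat)"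
  then have ij: "i < m" "j < k" by auto
  define d where "d = col D j"
  have d: "d \<in> carrier_vec n" using D ij by (simp add: d_def)
  have Md: "col (M * D) j = M *\<^sub>v d" using M D ij by (auto simp: d_def intro!: eq_vecI)
  have "M\<^sup>T *\<^sub>v (M *\<^sub>v d) = col (M\<^sup>T * (M * D)) j"
    using M D ij Md by (auto simp del: assoc_mult_mat intro!: eq_vecI)
  then have "M\<^sup>T *\<^sub>v (M *\<^sub>v d) = 0\<^sub>v n" using 0 ij by (simp add: col_zero)
  then have "(M *\<^sub>v d) \<bullet> (M *\<^sub>v d) = 0"
    using transpose_vec_mult_scalar[OF M d, of "M *\<^sub>v d"] M d by simp
  then have "M *\<^sub>v d = 0\<^sub>v m" using scalar_prod_self_eq_0_iff[of "M *\<^sub>v d" m] M d by simp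
  then have "col (M * D) j $ i = 0" using Md ij by simp
  then show "(M * D) $$ (i, j) = 0\<^sub>m m k $$ (i, j)" using ij M D by simp
qed (use M D in auto)

text \<open>
  The matrix \<open>X = G M\<^sup>T\<close> works for any generalised inverse \<open>G\<close> of the Gram matrix
  \<open>M\<^sup>T M\<close>: cancelling \<open>M\<^sup>T\<close> gives \<open>M G M\<^sup>T M = M\<close>, and then \<open>W = M G M\<^sup>T\<close> satisfies
  \<open>W W\<^sup>T = W\<^sup>T\<close>, so \<open>W\<close> is symmetric.
\<close>

lemma least_squares_g_inverse_exists:
  fixes M :: "real mat"
  assumes M: "M \<in> carrier_mat m n"
  obtains X where "X \<in> carrier_mat n m" "M * X * M = M" "(M * X)\<^sup>T = M * X"
proof -
  have MT: "M\<^sup>T \<in> carrier_mat n m" using M by simp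
  have N: "M\<^sup>T * M \<in> carrier_mat n n" using M MT by simp
  obtain G where G: "G \<in> carrier_mat n n" and NGN: "(M\<^sup>T * M) * G * (M\<^sup>T * M) = M\<^sup>T * M"
    using g_inverse_exists[OF N] by blast
  define D where "D = G * (M\<^sup>T * M) - 1\<^sub>m n"
  have GN: "G * (M\<^sup>T * M) \<in> carrier_mat n n" by (rule mult_carrier_mat[OF G N])
  have D: "D \<in> carrier_mat n n" unfolding D_def by (rule minus_carrier_mat[OF one_carrier_mat])
  have "M\<^sup>T * (M * D) = (M\<^sup>T * M) * D" using assoc_mult_mat[OF MT M D] by simp
  also have "\<dots> = (M\<^sup>T * M) * (G * (M\<^sup>T * M)) - M\<^sup>T * M"
    unfolding D_def mult_minus_distrib_mat[OF N GN one_carrier_mat] right_mult_one_mat[OF N] ..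
  also have "\<dots> = 0\<^sub>m n n" unfolding assoc_mult_mat[OF N G N, symmetric] NGN by (rule minus_r_inv_mat[OF N])
  finally have "M * D = 0\<^sub>m m n" by (rule gram_mult_eq_0_imp[OF M D])
  define W where "W = M * (G * M\<^sup>T)"
  have GMT: "G * M\<^sup>T \<in> carrier_mat n m" using G MT by simp
  have W: "W \<in> carrier_mat m m" using M GMT by (simp add: W_def)
  have MGN: "M * (G * (M\<^sup>T * M)) = M"
  proof -
    have "M * (G * (M\<^sup>T * M)) - M = 0\<^sub>m m n"
      using \<open>M * D = 0\<^sub>m m n\<close>
      unfolding D_def mult_minus_distrib_mat[OF M GN one_carrier_mat] right_mult_one_mat[OF M] .
    then show ?thesis by (rule minus_mat_eq_0_imp[OF mult_carrier_mat[OF M GN] M])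
  qed
  have WM: "W * M = M"
    unfolding W_def assoc_mult_mat[OF M GMT M] assoc_mult_mat[OF G MT M] by (rule MGN)
  have "W * W\<^sup>T = W\<^sup>T"
  proof -
    have GT: "G\<^sup>T * M\<^sup>T \<in> carrier_mat n m" "M * G\<^sup>T \<in> carrier_mat m n" using G MT M by auto
    have GT': "G\<^sup>T \<in> carrier_mat n n" using G by simp
    have WT: "W\<^sup>T = M * (G\<^sup>T * M\<^sup>T)"
      unfolding W_def transpose_mult[OF M GMT] transpose_mult[OF G MT] transpose_transpose
      by (rule assoc_mult_mat[OF M GT' MT])
    have "W * W\<^sup>T = W * M * (G\<^sup>T * M\<^sup>T)" unfolding WT by (rule assoc_mult_mat[OF W M GT(1), symmetric])
    then show ?thesis by (simp only: WM WT)
  qed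
  moreover have "(W * W\<^sup>T)\<^sup>T = W * W\<^sup>T" 
    using transpose_mult[OF W, of "W\<^sup>T" m] W by (simp only: transpose_carrier_mat transpose_transpose)
  ultimately have sym: "W\<^sup>T = W" by (metis transpose_transpose)
  show thesis using that[OF GMT] WM sym unfolding W_def by blast
qed

text \<open>
  If \<open>M X\<close> is symmetric with \<open>M X M = M\<close>, and \<open>H M\<close> is symmetric with \<open>M H M = M\<close>, then
  \<open>H M X\<close> solves all four Penrose equations. Such an \<open>H\<close> is the transpose of a
  least-squares inverse of \<open>M\<^sup>T\<close>.
\<close>

lemma pinv_exists:
  fixes M :: "real mat"
  shows "\<exists>X. is_pinv M X"
proof -
  define m n where "m = dim_row M" and "n = dim_col M"
  have M: "M \<in> carrier_mat m n" and MT: "M\<^sup>T \<in> carrier_mat n m" by (auto simp: m_def n_def)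
  obtain X where X: "X \<in> carrier_mat n m" and MXM: "M * X * M = M" and MX: "(M * X)\<^sup>T = M * X"
    using least_squares_g_inverse_exists[OF M] by blast
  obtain Y where Y: "Y \<in> carrier_mat m n" and MYM: "M\<^sup>T * Y * M\<^sup>T = M\<^sup>T" and MY: "(M\<^sup>T * Y)\<^sup>T = M\<^sup>T * Y"
    using least_squares_g_inverse_exists[OF MT] by blast
  define H where "H = Y\<^sup>T"
  have H: "H \<in> carrier_mat n m" using Y by (simp add: H_def)
  have HM: "H * M = M\<^sup>T * Y" using transpose_mult[OF MT Y] MY unfolding H_def transpose_transpose by simp
  have HM_sym: "(H * M)\<^sup>T = H * M" unfolding HM by (rule MY)
  have MHM: "M * (H * M) = M"
  proof -
    have "(M\<^sup>T * Y * M\<^sup>T)\<^sup>T = M * (M\<^sup>T * Y)\<^sup>T"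
      using transpose_mult[OF mult_carrier_mat[OF MT Y] MT] unfolding transpose_transpose .
    then show ?thesis unfolding MYM MY HM transpose_transpose by simp
  qed
  have HMc: "H * M \<in> carrier_mat n n" and MX_c: "M * X \<in> carrier_mat m m"
    and MHc: "M * H \<in> carrier_mat m m"
    using H M X by (auto intro: mult_carrier_mat)
  have Zc: "H * (M * X) \<in> carrier_mat n m" by (rule mult_carrier_mat[OF H MX_c])
  have 1: "M * (H * (M * X)) = M * X"
    unfolding assoc_mult_mat[OF M H MX_c, symmetric] assoc_mult_mat[OF MHc M X, symmetric]
      assoc_mult_mat[OF M H M] MHM ..
  have 2: "H * (M * X) * M = H * M" unfolding assoc_mult_mat[OF H MX_c M] MXM ..
  have 3: "H * (M * X) * M * (H * (M * X)) = H * (M * X)"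
    unfolding 2 assoc_mult_mat[OF H M Zc] 1 ..
  have "is_pinv M (H * (M * X))"
    unfolding is_pinv_def unfolding 1 2 3 MX HM_sym MXM
    using Zc 3 unfolding 2 by (simp add: m_def n_def)
  then show ?thesis by blast
qed

text \<open>
  Two solutions \<open>X\<close> and \<open>Y\<close> have \<open>M X = M Y\<close>, since \<open>M X = (M Y) (M X)\<close> transposes to
  \<open>(M X) (M Y) = M Y\<close>; likewise \<open>X M = Y M\<close>. Hence \<open>X = X M X = Y M X = Y M Y = Y\<close>.
\<close>

lemma is_pinv_unique:
  assumes "is_pinv M X" and "is_pinv M Y"
  shows "X = Y"
proof -
  define m n where "m = dim_row M" and "n = dim_col M"
  have M: "M \<in> carrier_mat m n" by (auto simp: m_def n_def)
  have X: "X \<in> carrier_mat n m" "M * X * M = M" "X * M * X = X" "(M * X)\<^sup>T = M * X" "(X * M)\<^sup>T = X * M"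
    using assms(1) by (auto simp: is_pinv_def m_def n_def)
  have Y: "Y \<in> carrier_mat n m" "M * Y * M = M" "Y * M * Y = Y" "(M * Y)\<^sup>T = M * Y" "(Y * M)\<^sup>T = Y * M"
    using assms(2) by (auto simp: is_pinv_def m_def n_def)
  have MX: "M * X \<in> carrier_mat m m" and MY: "M * Y \<in> carrier_mat m m"
    and XM: "X * M \<in> carrier_mat n n" and YM: "Y * M \<in> carrier_mat n n"
    using M X(1) Y(1) by (auto intro: mult_carrier_mat)
  have "M * X = (M * Y * (M * X))\<^sup>T" unfolding assoc_mult_mat[OF MY M X(1), symmetric] Y(2) X(4) ..
  also have "\<dots> = M * X * (M * Y)" unfolding transpose_mult[OF MY MX] X(4) Y(4) ..
  also have "\<dots> = M * Y" unfolding assoc_mult_mat[OF MX M Y(1), symmetric] X(2) ..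
  finally have 1: "M * X = M * Y" .
  have "X * M = (X * M * (Y * M))\<^sup>T"
    unfolding assoc_mult_mat[OF X(1) M YM] assoc_mult_mat[OF M Y(1) M, symmetric] Y(2) X(5) ..
  also have "\<dots> = Y * M * (X * M)" unfolding transpose_mult[OF XM YM] X(5) Y(5) ..
  also have "\<dots> = Y * M"
    unfolding assoc_mult_mat[OF Y(1) M XM] assoc_mult_mat[OF M X(1) M, symmetric] X(2) ..
  finally have 2: "X * M = Y * M" .
  have "X = Y * M * X" using X(3) unfolding 2 by simp
  also have "\<dots> = Y" unfolding assoc_mult_mat[OF Y(1) M X(1)] 1 assoc_mult_mat[OF Y(1) M Y(1), symmetric] by (rule Y(3))
  finally show ?thesis .
qed

lemma pinv_is_pinv: "is_pinv M (pinv M)"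
  unfolding pinv_def using pinv_exists is_pinv_unique by (metis theI)

lemma
  assumes M: "M \<in> carrier_mat m n"
  shows pinv_carrier: "pinv M \<in> carrier_mat n m"
    and mult_pinv_mult: "M * pinv M * M = M"
    and pinv_mult_pinv: "pinv M * M * pinv M = pinv M"
    and pinv_mult_symmetric: "(pinv M * M)\<^sup>T = pinv M * M"
  using pinv_is_pinv[of M] M by (auto simp: is_pinv_def)

section \<open>Column space and full row rank\<close>

lemma col_space_eq_range:
  fixes M :: "real mat"
  assumes "M \<in> carrier_mat n k"
  shows "vec_space.col_space n M = (\<lambda>x. M *\<^sub>v x) ` carrier_vec k"
  using vec_space.col_space_eq[OF assms] assms by (auto simp: image_iff)

text \<open>
  A maximal independent set of columns has \<open>n\<close> elements and is therefore a basis.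
\<close>

lemma full_rank_imp_surj:
  fixes M :: "real mat"
  assumes M: "M \<in> carrier_mat n k" and rank: "vec_space.rank n M = n" and y: "y \<in> carrier_vec n"
  obtains x where "x \<in> carrier_vec k" "M *\<^sub>v x = y"
proof -
  interpret vec_space "TYPE(real)" n .
  have sub: "set (cols M) \<subseteq> carrier_vec n" using cols_dim M by blast
  obtain W where W: "finite W" "maximal W (\<lambda>T. T \<subseteq> set (cols M) \<and> lin_indpt T)"
  proof -
    have "lin_indpt {}" by (rule finite_lin_indpt2) auto
    then have "\<exists>W. finite W \<and> maximal W (\<lambda>T. T \<subseteq> set (cols M) \<and> lin_indpt T) \<and> {} \<subseteq> W"
      by (intro maximal_exists_superset[of "set (cols M)"]) auto
    then show thesis using that by blast
  qed
  have Wc: "W \<subseteq> set (cols M)" and li: "lin_indpt W" using W by (auto simp: maximal_def)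
  have "basis W"
  proof (rule dim_li_is_basis[OF fin_dim W(1) _ li])
    show "W \<subseteq> carrier_vec n" using Wc sub by (rule order_trans)
    show "dim \<le> card W" using rank_card_indpt[OF M W(2)] rank dim_is_n by simp
  qed
  then have "span W = carrier_vec n" by (simp add: basis_def)
  then have "y \<in> span W" using y by simp
  then have "y \<in> col_space M" unfolding col_space_def using span_is_monotone[OF Wc] by blast
  then show thesis using that col_space_eq_range[OF M] by auto
qed

lemma surj_imp_full_rank:
  fixes M :: "real mat"
  assumes M: "M \<in> carrier_mat n k"
    and surj: "\<And>y. y \<in> carrier_vec n \<Longrightarrow> \<exists>x\<in>carrier_vec k. M *\<^sub>v x = y"
  shows "vec_space.rank n M = n"
proof -
  interpret vec_space "TYPE(real)" n .
  have "col_space M = carrier_vec n"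
    unfolding col_space_eq_range[OF M] using M surj by (auto simp: image_iff)
  then have "span_vs (set (cols M)) = V" by (simp add: col_space_def)
  then show ?thesis by (simp add: rank_def dim_is_n)
qed

section \<open>The orthogonal projector onto the row space\<close>

lemma pinv_mult_carrier: "M \<in> carrier_mat m n \<Longrightarrow> pinv M * M \<in> carrier_mat n n"
  using pinv_carrier by (metis mult_carrier_mat)

lemma pinv_mult_mult_vec:
  assumes "M \<in> carrier_mat m n" "x \<in> carrier_vec n"
  shows "pinv M * M *\<^sub>v x = pinv M *\<^sub>v (M *\<^sub>v x)"
  using assoc_mult_mat_vec[OF pinv_carrier[OF assms(1)] assms] .

lemma mult_proj_vec:
  assumes M: "M \<in> carrier_mat m n" and x: "x \<in> carrier_vec n"
  shows "M *\<^sub>v (pinv M * M *\<^sub>v x) = M *\<^sub>v x"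
  unfolding assoc_mult_mat_vec[OF M pinv_mult_carrier[OF M] x, symmetric]
    assoc_mult_mat[OF M pinv_carrier[OF M] M, symmetric] mult_pinv_mult[OF M] ..

lemma proj_pinv_vec:
  assumes M: "M \<in> carrier_mat m n" and y: "y \<in> carrier_vec m"
  shows "pinv M * M *\<^sub>v (pinv M *\<^sub>v y) = pinv M *\<^sub>v y"
  unfolding assoc_mult_mat_vec[OF pinv_mult_carrier[OF M] pinv_carrier[OF M] y, symmetric]
    pinv_mult_pinv[OF M] ..

lemma proj_idem_vec:
  assumes M: "M \<in> carrier_mat m n" and x: "x \<in> carrier_vec n"
  shows "pinv M * M *\<^sub>v (pinv M * M *\<^sub>v x) = pinv M * M *\<^sub>v x"
proof -
  have "M *\<^sub>v x \<in> carrier_vec m" using M x by simp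
  from proj_pinv_vec[OF M this] show ?thesis using pinv_mult_mult_vec[OF M x] by simp
qed

lemma proj_eq_transpose_mult:
  assumes M: "M \<in> carrier_mat m n" and x: "x \<in> carrier_vec n"
  shows "pinv M * M *\<^sub>v x = M\<^sup>T *\<^sub>v ((pinv M)\<^sup>T *\<^sub>v x)"
proof -
  have PT: "(pinv M)\<^sup>T \<in> carrier_mat m n" "M\<^sup>T \<in> carrier_mat n m" using pinv_carrier[OF M] M by auto
  have "pinv M * M = M\<^sup>T * (pinv M)\<^sup>T"
    using pinv_mult_symmetric[OF M] transpose_mult[OF pinv_carrier[OF M] M] by simp
  then show ?thesis using assoc_mult_mat_vec[OF PT(2,1) x] by simp
qed

lemma proj_form:
  assumes M: "M \<in> carrier_mat m n" and x: "x \<in> carrier_vec n"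
  shows "x \<bullet> (pinv M * M *\<^sub>v x) = (pinv M * M *\<^sub>v x) \<bullet> (pinv M * M *\<^sub>v x)"
proof -
  note P = pinv_mult_carrier[OF M]
  have Px: "pinv M * M *\<^sub>v x \<in> carrier_vec n" using P x by (rule mult_mat_vec_carrier)
  have "x \<bullet> (pinv M * M *\<^sub>v (pinv M * M *\<^sub>v x)) = (pinv M * M *\<^sub>v x) \<bullet> (pinv M * M *\<^sub>v x)"
    by (rule symmetric_scalar_prod[OF P pinv_mult_symmetric[OF M] x Px])
  then show ?thesis unfolding proj_idem_vec[OF M x] .
qed

lemma
  assumes M: "M \<in> carrier_mat m n" and x: "x \<in> carrier_vec n"
  shows proj_pythagoras: "x \<bullet> x = (pinv M * M *\<^sub>v x) \<bullet> (pinv M * M *\<^sub>v x)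
           + (x - pinv M * M *\<^sub>v x) \<bullet> (x - pinv M * M *\<^sub>v x)"
    and vnorm_proj_le: "vnorm (pinv M * M *\<^sub>v x) \<le> vnorm x"
    and vnorm_minus_proj_le: "vnorm (x - pinv M * M *\<^sub>v x) \<le> vnorm x"
proof -
  define z where "z = pinv M * M *\<^sub>v x"
  have z: "z \<in> carrier_vec n" unfolding z_def using pinv_mult_carrier[OF M] x by (rule mult_mat_vec_carrier)
  have xz: "x \<bullet> z = z \<bullet> z" unfolding z_def by (rule proj_form[OF M x])
  have "(x - z) \<bullet> (x - z) = x \<bullet> x - x \<bullet> z - (z \<bullet> x - z \<bullet> z)"
    using x z by (simp add: minus_scalar_prod_distrib[of _ n] scalar_prod_minus_distrib[of _ n])
  also have "z \<bullet> x = x \<bullet> z" using x z by (rule comm_scalar_prod[rotated])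
  finally have 1: "x \<bullet> x = z \<bullet> z + (x - z) \<bullet> (x - z)" using xz by simp
  then show "x \<bullet> x = (pinv M * M *\<^sub>v x) \<bullet> (pinv M * M *\<^sub>v x)
           + (x - pinv M * M *\<^sub>v x) \<bullet> (x - pinv M * M *\<^sub>v x)" by (simp add: z_def)
  show "vnorm (pinv M * M *\<^sub>v x) \<le> vnorm x" "vnorm (x - pinv M * M *\<^sub>v x) \<le> vnorm x"
    unfolding z_def[symmetric] vnorm_def
    using 1 scalar_prod_self_nonneg[of z] scalar_prod_self_nonneg[of "x - z"]
    by (auto intro!: real_sqrt_le_mono)
qed

text \<open>
  \<open>pinv M * M\<close> maps into the range of \<open>M\<^sup>T\<close> by symmetry, and \<open>M\<close> annihilates
  \<open>v - pinv M * M v\<close>, which says that this difference is orthogonal to the range of \<open>M\<^sup>T\<close>.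
\<close>

lemma orth_proj_row_space:
  assumes M: "M \<in> carrier_mat m n" and v: "v \<in> carrier_vec n"
  shows "orth_proj (vec_space.col_space n M\<^sup>T) v = pinv M * M *\<^sub>v v"
proof -
  define z where "z = pinv M * M *\<^sub>v v"
  define W where "W = vec_space.col_space n M\<^sup>T"
  have MT: "M\<^sup>T \<in> carrier_mat n m" using M by simp
  have W: "W = (\<lambda>y. M\<^sup>T *\<^sub>v y) ` carrier_vec m" unfolding W_def by (rule col_space_eq_range[OF MT])
  have z: "z \<in> carrier_vec n" unfolding z_def using pinv_mult_carrier[OF M] v by (rule mult_mat_vec_carrier)
  have zW: "z \<in> W"
    unfolding W z_def proj_eq_transpose_mult[OF M v] using pinv_carrier[OF M] v by auto
  have orth: "(w - u) \<bullet> (M\<^sup>T *\<^sub>v y) = (M *\<^sub>v w - M *\<^sub>v u) \<bullet> y"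
    if "w \<in> carrier_vec n" "u \<in> carrier_vec n" "y \<in> carrier_vec m" for w u y
  proof -
    have wu: "w - u \<in> carrier_vec n" using that by simp
    have "(w - u) \<bullet> (M\<^sup>T *\<^sub>v y) = (M *\<^sub>v (w - u)) \<bullet> y"
      using transpose_vec_mult_scalar[OF MT that(3) wu] by simp
    then show ?thesis using mult_minus_distrib_mat_vec[OF M that(1,2)] by simp
  qed
  show ?thesis unfolding orth_proj_def W_def[symmetric] z_def[symmetric]
  proof (rule the_equality)
    have "M *\<^sub>v v - M *\<^sub>v z = 0\<^sub>v m" unfolding z_def mult_proj_vec[OF M v] using M v by simp
    then show "z \<in> W \<and> (\<forall>u\<in>W. (v - z) \<bullet> u = 0)" using zW orth[OF v z] by (auto simp: W)
  next
    fix w assume "w \<in> W \<and> (\<forall>u\<in>W. (v - w) \<bullet> u = 0)"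
    then have wW: "w \<in> W" and w0: "\<And>y. y \<in> carrier_vec m \<Longrightarrow> (v - w) \<bullet> (M\<^sup>T *\<^sub>v y) = 0"
      by (auto simp: W)
    from wW obtain a where a: "a \<in> carrier_vec m" "w = M\<^sup>T *\<^sub>v a" by (auto simp: W)
    have w: "w \<in> carrier_vec n" using a MT by simp
    define s where "s = M *\<^sub>v v - M *\<^sub>v w"
    have s: "s \<in> carrier_vec m" unfolding s_def using M v w by auto
    have "s \<bullet> s = 0" using orth[OF v w s] w0[OF s] by (simp add: s_def)
    then have s0: "s = 0\<^sub>v m" using scalar_prod_self_eq_0_iff[OF s] by simp
    \<comment> \<open>\<open>w\<close> lies in the row space, so it is fixed by the projector, and \<open>M w = M v\<close>.\<close>
    have "w = z"
    proof -
      have "M *\<^sub>v w = M *\<^sub>v v"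
      proof (rule eq_vecI)
        fix i assume "i < dim_vec (M *\<^sub>v v)"
        then have "i < m" using M by simp
        moreover from this have "s $ i = 0" by (simp add: s0)
        ultimately show "(M *\<^sub>v w) $ i = (M *\<^sub>v v) $ i" using M by (simp add: s_def)
      qed (use M in simp)
      then have "pinv M * M *\<^sub>v w = z"
        unfolding z_def pinv_mult_mult_vec[OF M w] pinv_mult_mult_vec[OF M v] by simp
      moreover have "pinv M * M *\<^sub>v w = w"
      proof -
        have "(pinv M * M) * M\<^sup>T = (M * (pinv M * M)\<^sup>T)\<^sup>T"
          using transpose_mult[OF M, of "(pinv M * M)\<^sup>T" n] pinv_mult_carrier[OF M] by simp
        also have "\<dots> = M\<^sup>T"
          unfolding pinv_mult_symmetric[OF M] assoc_mult_mat[OF M pinv_carrier[OF M] M, symmetric]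
            mult_pinv_mult[OF M] ..
        finally show ?thesis
          unfolding a(2) using assoc_mult_mat_vec[OF pinv_mult_carrier[OF M] MT a(1)] by simp
      qed
      ultimately show ?thesis by simp
    qed
    then show "w = z" .
  qed
qed

text \<open>
  The convention that the angle to the zero vector has cosine \<open>0\<close> makes the product formula
  valid for every \<open>v\<close>.
\<close>

lemma cos_angle_row_space:
  assumes M: "M \<in> carrier_mat m n" and v: "v \<in> carrier_vec n"
  shows "vnorm (pinv M * M *\<^sub>v v) = cos_angle v (vec_space.col_space n M\<^sup>T) * vnorm v"
    and "0 \<le> cos_angle v (vec_space.col_space n M\<^sup>T)"
proof -
  show "0 \<le> cos_angle v (vec_space.col_space n M\<^sup>T)" by (simp add: cos_angle_def)
  show "vnorm (pinv M * M *\<^sub>v v) = cos_angle v (vec_space.col_space n M\<^sup>T) * vnorm v"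
  proof (cases "v = 0\<^sub>v n")
    case True
    have "vnorm (pinv M * M *\<^sub>v v) \<le> vnorm v" by (rule vnorm_proj_le[OF M v])
    then show ?thesis using True vnorm_eq_0_iff[OF v] by (simp add: antisym)
  next
    case False
    then show ?thesis using v vnorm_eq_0_iff[OF v] orth_proj_row_space[OF M v]
      by (simp add: cos_angle_def)
  qed
qed

section \<open>Matrices of full row rank\<close>

lemma gram_form:
  fixes M :: "real mat"
  assumes M: "M \<in> carrier_mat r n" and w: "w \<in> carrier_vec r"
  shows "w \<bullet> (M * M\<^sup>T *\<^sub>v w) = (M\<^sup>T *\<^sub>v w) \<bullet> (M\<^sup>T *\<^sub>v w)"
proof -
  have MT: "M\<^sup>T \<in> carrier_mat n r" using M by simp
  have MTw: "M\<^sup>T *\<^sub>v w \<in> carrier_vec n" using MT w by simp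
  show ?thesis unfolding assoc_mult_mat_vec[OF M MT w]
    using transpose_vec_mult_scalar[OF M MTw w] by simp
qed

lemma gram_symmetric: "(M * M\<^sup>T)\<^sup>T = M * (M :: real mat)\<^sup>T"
proof -
  have "M \<in> carrier_mat (dim_row M) (dim_col M)" "M\<^sup>T \<in> carrier_mat (dim_col M) (dim_row M)" by auto
  from transpose_mult[OF this] show ?thesis by simp
qed

lemma lambda_min_gram_le:
  fixes M :: "real mat"
  assumes M: "M \<in> carrier_mat r n" and r: "0 < r" and w: "w \<in> carrier_vec r"
  shows "lambda_min (M * M\<^sup>T) * (w \<bullet> w) \<le> (M\<^sup>T *\<^sub>v w) \<bullet> (M\<^sup>T *\<^sub>v w)"
proof -
  have "M * M\<^sup>T \<in> carrier_mat r r" using M by (intro mult_carrier_mat) auto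
  from lambda_min_le_form[OF this gram_symmetric r w] show ?thesis using gram_form[OF M w] by simp
qed

text \<open>
  \<open>M M\<^sup>T\<close> is invertible, so \<open>M\<close> can be cancelled from the right in
  \<open>(M pinv M) M = M\<close>.
\<close>

lemma lambda_min_gram_pos_imp_right_inverse:
  fixes M :: "real mat"
  assumes M: "M \<in> carrier_mat r n" and r: "0 < r" and pos: "0 < lambda_min (M * M\<^sup>T)"
  shows "M * pinv M = 1\<^sub>m r"
proof -
  have MT: "M\<^sup>T \<in> carrier_mat n r" using M by simp
  have N: "M * M\<^sup>T \<in> carrier_mat r r" using M MT by (rule mult_carrier_mat)
  obtain G where G: "G \<in> carrier_mat r r" "M * M\<^sup>T * G = 1\<^sub>m r"
  proof (rule square_inverse_if_trivial_kernel[OF N])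
    fix w assume w: "w \<in> carrier_vec r" and 0: "M * M\<^sup>T *\<^sub>v w = 0\<^sub>v r"
    have "lambda_min (M * M\<^sup>T) * (w \<bullet> w) \<le> 0"
      using lambda_min_le_form[OF N gram_symmetric r w] 0 w by simp
    then have "w \<bullet> w = 0" using pos scalar_prod_self_nonneg[of w] by (simp add: mult_le_0_iff)
    then show "w = 0\<^sub>v r" using scalar_prod_self_eq_0_iff[OF w] by simp
  qed
  have P: "pinv M \<in> carrier_mat n r" by (rule pinv_carrier[OF M])
  have MP: "M * pinv M \<in> carrier_mat r r" using M P by (rule mult_carrier_mat)
  have "M * pinv M = M * pinv M * (M * M\<^sup>T * G)" unfolding G(2) using right_mult_one_mat[OF MP] by simp
  also have "\<dots> = M * pinv M * M * M\<^sup>T * G"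
    unfolding assoc_mult_mat[OF MP N G(1), symmetric] assoc_mult_mat[OF MP M MT, symmetric] ..
  also have "\<dots> = 1\<^sub>m r" unfolding mult_pinv_mult[OF M] by (rule G(2))
  finally show ?thesis .
qed

lemma right_inverse_imp_mat_rank:
  assumes M: "M \<in> carrier_mat r n" and inv: "M * pinv M = 1\<^sub>m r"
  shows "mat_rank M = r" and "r \<le> n"
proof -
  have P: "pinv M \<in> carrier_mat n r" by (rule pinv_carrier[OF M])
  have "vec_space.rank r M = r"
  proof (rule surj_imp_full_rank[OF M])
    fix y :: "real vec" assume y: "y \<in> carrier_vec r"
    then have "M *\<^sub>v (pinv M *\<^sub>v y) = y" using assoc_mult_mat_vec[OF M P y] inv by simp
    moreover have "pinv M *\<^sub>v y \<in> carrier_vec n" using P y by simp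
    ultimately show "\<exists>x\<in>carrier_vec n. M *\<^sub>v x = y" by blast
  qed
  then show "mat_rank M = r" "r \<le> n"
    using M vec_space.rank_le_nc[OF M] by (auto simp: mat_rank_def)
qed

text \<open>
  For \<open>z = pinv M y\<close> there is a \<open>w\<close> with \<open>z = M\<^sup>T w\<close>, because \<open>z\<close> lies in the row space. The
  squared norm of \<open>z\<close> is then the scalar product of \<open>w\<close> and \<open>M z = y\<close>, while \<open>sqrt \<alpha>\<close> times
  the norm of \<open>w\<close> is at most the norm of \<open>z\<close>.
\<close>

lemma vnorm_pinv_le:
  assumes M: "M \<in> carrier_mat r n" and r: "0 < r" and \<alpha>: "0 < \<alpha>" "\<alpha> \<le> lambda_min (M * M\<^sup>T)"
    and y: "y \<in> carrier_vec r"
  shows "vnorm (pinv M *\<^sub>v y) \<le> vnorm y / sqrt \<alpha>"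
proof -
  have P: "pinv M \<in> carrier_mat n r" by (rule pinv_carrier[OF M])
  have MP: "M * pinv M = 1\<^sub>m r" using lambda_min_gram_pos_imp_right_inverse[OF M r] \<alpha> by simp
  define z where "z = pinv M *\<^sub>v y"
  define w where "w = (pinv M)\<^sup>T *\<^sub>v z"
  have z: "z \<in> carrier_vec n" using P y by (simp add: z_def)
  have w: "w \<in> carrier_vec r" using P z by (simp add: w_def)
  have zw: "z = M\<^sup>T *\<^sub>v w"
    using proj_eq_transpose_mult[OF M z] proj_pinv_vec[OF M y] unfolding w_def z_def by simp
  have Mz: "M *\<^sub>v z = y" unfolding z_def using assoc_mult_mat_vec[OF M P y] MP y by simp
  have "z \<bullet> z = w \<bullet> y"
    using transpose_vec_mult_scalar[OF M z w] unfolding Mz zw[symmetric] .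
  also have "\<dots> \<le> vnorm w * vnorm y" using cauchy_schwarz_vec[OF w y] by simp
  finally have 1: "(vnorm z)\<^sup>2 \<le> vnorm w * vnorm y" by (simp add: vnorm_power2)
  have "\<alpha> * (w \<bullet> w) \<le> lambda_min (M * M\<^sup>T) * (w \<bullet> w)" using \<alpha> by (intro mult_right_mono) auto
  also have "\<dots> \<le> z \<bullet> z" using lambda_min_gram_le[OF M r w] by (simp add: zw)
  finally have "(sqrt \<alpha> * vnorm w)\<^sup>2 \<le> (vnorm z)\<^sup>2" using \<alpha> by (simp add: power_mult_distrib vnorm_power2)
  then have 2: "sqrt \<alpha> * vnorm w \<le> vnorm z" by (rule power2_le_imp_le) simp
  have "vnorm z * (sqrt \<alpha> * vnorm z) = sqrt \<alpha> * (vnorm z)\<^sup>2" by (simp add: power2_eq_square)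
  also have "\<dots> \<le> sqrt \<alpha> * (vnorm w * vnorm y)" using 1 \<alpha> by (intro mult_left_mono) auto
  also have "\<dots> = (sqrt \<alpha> * vnorm w) * vnorm y" by simp
  also have "\<dots> \<le> vnorm z * vnorm y" using 2 by (intro mult_right_mono) auto
  finally have "vnorm z = 0 \<or> sqrt \<alpha> * vnorm z \<le> vnorm y"
    using vnorm_nonneg[of z] by (auto simp: mult_le_cancel_left less_le)
  then have "sqrt \<alpha> * vnorm z \<le> vnorm y" by auto
  then show ?thesis unfolding z_def[symmetric] using \<alpha> by (simp add: field_simps)
qed

lemma
  fixes V :: "real mat"
  assumes V: "V \<in> carrier_mat n n" and r: "r \<le> n"
  shows leading_cols_carrier: "leading_cols r V \<in> carrier_mat n r"
    and leading_cols_index: "i < n \<Longrightarrow> j < r \<Longrightarrow> leading_cols r V $$ (i, j) = V $$ (i, j)"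
  using assms by (auto simp: leading_cols_def mat_of_cols_def)

text \<open>
  The right inverse forces \<open>r \<le> n\<close>, so only the first \<open>r\<close> columns \<open>L\<close> of \<open>V\<close> enter the
  decomposition: \<open>M = T L\<^sup>T\<close> with a square \<open>T\<close>, which is invertible because \<open>M\<close> has a right
  inverse. The symmetric matrices \<open>Q = pinv M * M\<close> and \<open>K = L L\<^sup>T\<close> therefore satisfy
  \<open>Q K = Q\<close> and \<open>K Q = K\<close>, and transposing the first equation gives \<open>Q = K\<close>.
\<close>

lemma proj_eq_leading_cols_gram:
  assumes M: "M \<in> carrier_mat r n" and inv: "M * pinv M = 1\<^sub>m r" and svd: "full_svd M U S V"
  shows "pinv M * M = leading_cols (mat_rank M) V * (leading_cols (mat_rank M) V)\<^sup>T"
proof -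
  have rank: "mat_rank M = r" and rn: "r \<le> n" using right_inverse_imp_mat_rank[OF M inv] by auto
  define L where "L = leading_cols r V"
  have U: "U \<in> carrier_mat r r" and V: "V \<in> carrier_mat n n" and S: "S \<in> carrier_mat r n"
    and VV: "V\<^sup>T * V = 1\<^sub>m n" and diag: "diagonal_mat S" and MU: "M = U * S * V\<^sup>T"
    using svd unfolding full_svd_def orthonormal_mat_def inverts_mat_def carrier_matD[OF M] by auto
  have L: "L \<in> carrier_mat n r" unfolding L_def by (rule leading_cols_carrier[OF V rn])
  have LT: "L\<^sup>T \<in> carrier_mat r n" and VT: "V\<^sup>T \<in> carrier_mat n n" using L V by auto
  note L_index = leading_cols_index[OF V rn, folded L_def]
  have LL: "L\<^sup>T * L = 1\<^sub>m r"
  proof (rule eq_matI)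
    fix i j assume "i < dim_row (1\<^sub>m r :: real mat)" "j < dim_col (1\<^sub>m r :: real mat)"
    then have ij: "i < r" "j < r" by auto
    have "(L\<^sup>T * L) $$ (i, j) = (V\<^sup>T * V) $$ (i, j)"
      using ij rn L V by (simp add: scalar_prod_def L_index)
    then show "(L\<^sup>T * L) $$ (i, j) = 1\<^sub>m r $$ (i, j)" using ij rn VV by simp
  qed (use L in auto)
  define S' where "S' = mat r r (\<lambda>ij. S $$ ij)"
  define T where "T = U * S'"
  have S': "S' \<in> carrier_mat r r" by (simp add: S'_def)
  have T: "T \<in> carrier_mat r r" unfolding T_def using U S' by (rule mult_carrier_mat)
  have "S * V\<^sup>T = S' * L\<^sup>T"
  proof (rule eq_matI)
    fix i j assume "i < dim_row (S' * L\<^sup>T)" "j < dim_col (S' * L\<^sup>T)"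
    then have ij: "i < r" "j < n" using S' L by auto
    have off: "S $$ (i, k) = 0" if "k < n" "k \<noteq> i" for k
      using diag S ij that by (auto simp: diagonal_mat_def)
    have "(S * V\<^sup>T) $$ (i, j) = (\<Sum>k<n. S $$ (i, k) * V $$ (j, k))"
      using ij S V by (simp add: scalar_prod_def lessThan_atLeast0)
    also have "\<dots> = (\<Sum>k<n. if k = i then S $$ (i, i) * V $$ (j, i) else 0)"
      using off by (intro sum.cong) auto
    also have "\<dots> = (\<Sum>k<r. if k = i then S $$ (i, i) * V $$ (j, i) else 0)"
      using ij rn by simp
    also have "\<dots> = (\<Sum>k<r. S' $$ (i, k) * L $$ (j, k))"
      using off ij rn by (intro sum.cong) (auto simp: S'_def L_index)
    also have "\<dots> = (S' * L\<^sup>T) $$ (i, j)"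
      using ij S' L by (simp add: scalar_prod_def lessThan_atLeast0)
    finally show "(S * V\<^sup>T) $$ (i, j) = (S' * L\<^sup>T) $$ (i, j)" .
  qed (use S V S' L in auto)
  then have MT: "M = T * L\<^sup>T"
    unfolding MU T_def assoc_mult_mat[OF U S VT] assoc_mult_mat[OF U S' LT] by simp
  have P: "pinv M \<in> carrier_mat n r" by (rule pinv_carrier[OF M])
  define G where "G = L\<^sup>T * pinv M"
  have G: "G \<in> carrier_mat r r" unfolding G_def using LT P by (rule mult_carrier_mat)
  have "T * G = 1\<^sub>m r"
    unfolding G_def assoc_mult_mat[OF T LT P, symmetric] MT[symmetric] by (rule inv)
  then have GT: "G * T = 1\<^sub>m r" by (rule mat_mult_left_right_inverse[OF T G])
  define Q where "Q = pinv M * M"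
  define K where "K = L * L\<^sup>T"
  have Q: "Q \<in> carrier_mat n n" unfolding Q_def by (rule pinv_mult_carrier[OF M])
  have K: "K \<in> carrier_mat n n" unfolding K_def using L LT by (rule mult_carrier_mat)
  have LQ: "L\<^sup>T * Q = L\<^sup>T"
  proof -
    have "L\<^sup>T * Q = G * M" unfolding Q_def G_def by (rule assoc_mult_mat[OF LT P M, symmetric])
    also have "\<dots> = G * (T * L\<^sup>T)" using MT by simp
    also have "\<dots> = L\<^sup>T" unfolding assoc_mult_mat[OF G T LT, symmetric] GT using LT by simp
    finally show ?thesis .
  qed
  have KQ: "K * Q = K" unfolding K_def assoc_mult_mat[OF L LT Q] LQ ..
  have MK: "M * K = M"
  proof -
    have LTL: "L\<^sup>T * K = L\<^sup>T"
      unfolding K_def assoc_mult_mat[OF LT L LT, symmetric] LL using LT by simp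
    have "M * K = T * (L\<^sup>T * K)" using MT assoc_mult_mat[OF T LT K] by simp
    then show ?thesis unfolding LTL using MT by simp
  qed
  have QK: "Q * K = Q" unfolding Q_def assoc_mult_mat[OF P M K] MK ..
  have "Q\<^sup>T = Q" unfolding Q_def by (rule pinv_mult_symmetric[OF M])
  moreover have KT: "K\<^sup>T = K" unfolding K_def by (rule gram_symmetric)
  ultimately have "Q = (Q * K)\<^sup>T" unfolding QK by simp
  also have "\<dots> = K * Q" unfolding transpose_mult[OF Q K] KT \<open>Q\<^sup>T = Q\<close> ..
  finally have "Q = K" unfolding KQ .
  then show ?thesis unfolding rank Q_def K_def L_def .
qed

section \<open>Row blocks and the concatenated matrix of singular vectors\<close>

lemma row_block_carrier:
  "M \<in> carrier_mat m n \<Longrightarrow> row_block M I \<in> carrier_mat (card {i. i < m \<and> i \<in> I}) n"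
  by (auto simp: row_block_def submatrix_def)

lemma subvec_carrier: "v \<in> carrier_vec m \<Longrightarrow> subvec v I \<in> carrier_vec (card {i. i < m \<and> i \<in> I})"
  by (auto simp: subvec_def)

lemma row_block_mult_vec:
  assumes M: "M \<in> carrier_mat m n" and x: "x \<in> carrier_vec n"
  shows "row_block M I *\<^sub>v x = subvec (M *\<^sub>v x) I"
proof (rule eq_vecI)
  fix i assume "i < dim_vec (subvec (M *\<^sub>v x) I)"
  then have i: "i < card {i. i < m \<and> i \<in> I}" using M by (simp add: subvec_def)
  then have "pick I i < m" by (rule pick_le)
  then show "(row_block M I *\<^sub>v x) $ i = subvec (M *\<^sub>v x) I $ i"
    using M x i by (simp add: row_block_def subvec_def scalar_prod_def submatrix_def pick_UNIV)
qed (use M in \<open>simp add: row_block_def subvec_def submatrix_def\<close>)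

lemma subvec_minus:
  assumes u: "u \<in> carrier_vec m" and v: "v \<in> carrier_vec m"
  shows "subvec (u - v) I = subvec u I - subvec v I"
proof (rule eq_vecI)
  fix i assume "i < dim_vec (subvec u I - subvec v I)"
  then have i: "i < card {i. i < m \<and> i \<in> I}" using v by (simp add: subvec_def)
  then have "pick I i < m" by (rule pick_le)
  then show "subvec (u - v) I $ i = (subvec u I - subvec v I) $ i"
    using u v i by (simp add: subvec_def)
qed (use u v in \<open>simp add: subvec_def\<close>)

text \<open>
  \<open>pick I\<close> is strictly increasing, so the entries of \<open>subvec v I\<close> are entries of \<open>v\<close> at
  distinct positions.
\<close>

lemma vnorm_subvec_le: "vnorm (subvec v I) \<le> vnorm v"
proof -
  define c where "c = card {i. i < dim_vec v \<and> i \<in> I}"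
  have pick_lt: "pick I i < dim_vec v" if "i < c" for i using that unfolding c_def by (rule pick_le)
  have pick_strict: "pick I i < pick I j" if "i < j" "j < c" for i j
  proof (rule pick_mono[OF _ that(1)])
    show "j < card I \<or> infinite I"
    proof (cases "finite I")
      case True
      then have "c \<le> card I" unfolding c_def by (intro card_mono) auto
      then show ?thesis using that by simp
    qed simp
  qed
  have inj: "inj_on (pick I) {..<c}"
  proof (rule inj_onI, goal_cases)
    case (1 i j)
    then show ?case using pick_strict[of i j] pick_strict[of j i] by (cases i j rule: linorder_cases) auto
  qed
  have "subvec v I \<bullet> subvec v I = (\<Sum>i<c. (v $ pick I i)\<^sup>2)"
    by (simp add: subvec_def scalar_prod_def c_def lessThan_atLeast0 power2_eq_square)
  also have "\<dots> = (\<Sum>j\<in>pick I ` {..<c}. (v $ j)\<^sup>2)" using inj by (simp add: sum.reindex)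
  also have "\<dots> \<le> (\<Sum>j<dim_vec v. (v $ j)\<^sup>2)" using pick_lt by (intro sum_mono2) auto
  also have "\<dots> = v \<bullet> v" by (simp add: scalar_prod_def lessThan_atLeast0 power2_eq_square)
  finally show ?thesis unfolding vnorm_def by (rule real_sqrt_le_mono)
qed

lemma gram_index:
  fixes C :: "real mat"
  assumes "C \<in> carrier_mat n k" "a < n" "b < n"
  shows "(C * C\<^sup>T) $$ (a, b) = (\<Sum>j<k. C $$ (a, j) * C $$ (b, j))"
  using assms by (simp add: scalar_prod_def atLeast0LessThan)

lemma mat_of_cols_gram_index:
  fixes cs :: "real vec list"
  assumes "a < n" "b < n"
  shows "(mat_of_cols n cs * (mat_of_cols n cs)\<^sup>T) $$ (a, b) = (\<Sum>c\<leftarrow>cs. c $ a * c $ b)"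
  using assms
  by (simp add: scalar_prod_def mat_of_cols_index sum_list_sum_nth atLeast0LessThan)

lemma gram_index_cols:
  fixes L :: "real mat"
  assumes L: "L \<in> carrier_mat n r" and ab: "a < n" "b < n"
  shows "(\<Sum>c\<leftarrow>cols (s \<cdot>\<^sub>m L). c $ a * c $ b) = s\<^sup>2 * (L * L\<^sup>T) $$ (a, b)"
proof -
  have "(\<Sum>c\<leftarrow>cols (s \<cdot>\<^sub>m L). c $ a * c $ b) = (\<Sum>j<r. (s * L $$ (a, j)) * (s * L $$ (b, j)))"
    using L ab by (simp add: sum_list_sum_nth atLeast0LessThan)
  also have "\<dots> = s\<^sup>2 * (\<Sum>j<r. L $$ (a, j) * L $$ (b, j))"
    unfolding sum_distrib_left by (intro sum.cong) (auto simp: power2_eq_square)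
  also have "(\<Sum>j<r. L $$ (a, j) * L $$ (b, j)) = (L * L\<^sup>T) $$ (a, b)"
    using L ab by (simp add: scalar_prod_def atLeast0LessThan)
  finally show ?thesis .
qed

lemma sum_list_concat_map:
  "(\<Sum>c\<leftarrow>concat (map g xs). f c) = (\<Sum>x\<leftarrow>xs. \<Sum>c\<leftarrow>g x. f c)"
  for f :: "'a \<Rightarrow> 'b :: comm_monoid_add"
  by (induction xs) simp_all

text \<open>
  The Gram matrix of a horizontal concatenation is the sum of the Gram matrices of its parts;
  the scaling factors of the blocks enter squared and become the sampling probabilities.
\<close>

lemma block_V_mat_gram_index:
  fixes M :: "real mat" and V :: "nat \<Rightarrow> real mat" and \<tau> :: "nat \<Rightarrow> nat set"
  defines "L \<equiv> (\<lambda>i. leading_cols (mat_rank (row_block M (\<tau> i))) (V i))"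
  assumes L: "\<And>i. i \<in> {1..p} \<Longrightarrow> \<exists>r. L i \<in> carrier_mat n r" and n: "dim_col M = n"
    and ab: "a < n" "b < n"
  shows "(block_V_mat M \<tau> p V * (block_V_mat M \<tau> p V)\<^sup>T) $$ (a, b)
    = (\<Sum>i=1..p. (frob_norm (row_block M (\<tau> i)))\<^sup>2 / (frob_norm M)\<^sup>2 * (L i * (L i)\<^sup>T) $$ (a, b))"
proof -
  define cs where "cs = concat (map (\<lambda>i. cols (frob_norm (row_block M (\<tau> i)) \<cdot>\<^sub>m L i)) [1..<Suc p])"
  define C where "C = mat_of_cols n cs"
  have C: "C \<in> carrier_mat n (length cs)" "C\<^sup>T \<in> carrier_mat (length cs) n" by (auto simp: C_def)
  have block: "block_V_mat M \<tau> p V = (1 / frob_norm M) \<cdot>\<^sub>m C"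
    by (simp only: block_V_mat_def C_def cs_def L_def n)
  have "(block_V_mat M \<tau> p V * (block_V_mat M \<tau> p V)\<^sup>T) $$ (a, b) = (1 / frob_norm M)\<^sup>2 * (C * C\<^sup>T) $$ (a, b)"
  proof -
    have entry: "(s \<cdot>\<^sub>m C) $$ (i, j) = s * C $$ (i, j)" if "i < n" "j < length cs" for s i j
      using C(1) that by (intro index_smult_mat(1)) auto
    have "(block_V_mat M \<tau> p V * (block_V_mat M \<tau> p V)\<^sup>T) $$ (a, b)
        = (\<Sum>j<length cs. (1 / frob_norm M * C $$ (a, j)) * (1 / frob_norm M * C $$ (b, j)))"
      unfolding block gram_index[OF smult_carrier_mat[OF C(1)] ab]
      using ab entry by (intro sum.cong refl) auto
    also have "\<dots> = (\<Sum>j<length cs. (1 / frob_norm M)\<^sup>2 * (C $$ (a, j) * C $$ (b, j)))"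
      by (intro sum.cong refl) (simp add: power2_eq_square)
    also have "\<dots> = (1 / frob_norm M)\<^sup>2 * (C * C\<^sup>T) $$ (a, b)"
      unfolding gram_index[OF C(1) ab] by (rule sum_distrib_left[symmetric])
    finally show ?thesis .
  qed
  also have "(C * C\<^sup>T) $$ (a, b) = (\<Sum>c\<leftarrow>cs. c $ a * c $ b)"
    unfolding C_def by (rule mat_of_cols_gram_index[OF ab])
  also have "\<dots> = (\<Sum>i\<leftarrow>[1..<Suc p]. \<Sum>c\<leftarrow>cols (frob_norm (row_block M (\<tau> i)) \<cdot>\<^sub>m L i). c $ a * c $ b)"
    unfolding cs_def by (rule sum_list_concat_map)
  also have "\<dots> = (\<Sum>i=1..p. \<Sum>c\<leftarrow>cols (frob_norm (row_block M (\<tau> i)) \<cdot>\<^sub>m L i). c $ a * c $ b)"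
    by (simp only: sum_list_distinct_conv_sum_set distinct_upt set_upt atLeastLessThanSuc_atLeastAtMost)
  also have "\<dots> = (\<Sum>i=1..p. (frob_norm (row_block M (\<tau> i)))\<^sup>2 * (L i * (L i)\<^sup>T) $$ (a, b))"
  proof (rule sum.cong[OF refl])
    fix i assume "i \<in> {1..p}"
    then obtain r where "L i \<in> carrier_mat n r" using L by blast
    from gram_index_cols[OF this ab]
    show "(\<Sum>c\<leftarrow>cols (frob_norm (row_block M (\<tau> i)) \<cdot>\<^sub>m L i). c $ a * c $ b)
        = (frob_norm (row_block M (\<tau> i)))\<^sup>2 * (L i * (L i)\<^sup>T) $$ (a, b)" .
  qed
  finally show ?thesis by (simp add: sum_distrib_left power_divide sum_divide_distrib)
qed

lemma block_V_mat_carrier: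
  assumes "dim_col M = n"
  shows "block_V_mat M \<tau> p V \<in> carrier_mat n (dim_col (block_V_mat M \<tau> p V))"
proof (rule carrier_matI)
  show "dim_row (block_V_mat M \<tau> p V) = n"
    unfolding block_V_mat_def assms by (simp only: index_smult_mat mat_of_cols_carrier)
qed simp

section \<open>Symmetric contractions and affine recursions\<close>

lemma vnorm_weighted_sum_le:
  assumes "finite I" and q: "\<And>i. i \<in> I \<Longrightarrow> 0 \<le> q i" and v: "\<And>i. i \<in> I \<Longrightarrow> v i \<in> carrier_vec n"
  shows "vnorm (vec n (\<lambda>a. \<Sum>i\<in>I. q i * v i $ a)) \<le> (\<Sum>i\<in>I. q i * vnorm (v i))"
  using assms
proof (induction I rule: finite_induct)
  case empty
  have "vec n (\<lambda>a. 0 :: real) = 0\<^sub>v n" by auto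
  then show ?case using vnorm_eq_0_iff[of "0\<^sub>v n" n] by simp
next
  case (insert j I)
  have "vec n (\<lambda>a. \<Sum>i\<in>insert j I. q i * v i $ a) = q j \<cdot>\<^sub>v v j + vec n (\<lambda>a. \<Sum>i\<in>I. q i * v i $ a)"
    using insert.hyps carrier_vecD[OF insert.prems(2)[of j]] by (intro eq_vecI) auto
  also have "vnorm \<dots> \<le> vnorm (q j \<cdot>\<^sub>v v j) + vnorm (vec n (\<lambda>a. \<Sum>i\<in>I. q i * v i $ a))"
    using insert by (intro vnorm_add_le[of _ n]) auto
  also have "\<dots> \<le> q j * vnorm (v j) + (\<Sum>i\<in>I. q i * vnorm (v i))"
    using insert by (intro add_mono) (auto simp: vnorm_smult)
  finally show ?case using insert by simp
qed

text \<open>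
  For \<open>C = I - B\<close> the form lies between \<open>0\<close> and \<open>1 - lambda_min B\<close> times the squared norm.
  Applying \<open>psd_image_bound\<close> and then the upper bound on the form gives the operator norm.
\<close>

lemma symmetric_contraction:
  fixes B :: "real mat"
  assumes B: "B \<in> carrier_mat n n" and sym: "B\<^sup>T = B" and n: "0 < n"
    and le: "\<And>x. x \<in> carrier_vec n \<Longrightarrow> x \<bullet> (B *\<^sub>v x) \<le> x \<bullet> x"
  shows "lambda_min B \<le> 1"
    and "x \<in> carrier_vec n \<Longrightarrow> vnorm (x - B *\<^sub>v x) \<le> (1 - lambda_min B) * vnorm x"
proof -
  define \<eta> where "\<eta> = lambda_min B"
  define C where "C = 1\<^sub>m n - B"
  have C: "C \<in> carrier_mat n n" unfolding C_def by (rule minus_carrier_mat[OF B])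
  have Cx: "C *\<^sub>v x = x - B *\<^sub>v x" if x: "x \<in> carrier_vec n" for x
    unfolding C_def using minus_mult_distrib_mat_vec[OF one_carrier_mat B x] x by simp
  have form: "x \<bullet> (C *\<^sub>v x) = x \<bullet> x - x \<bullet> (B *\<^sub>v x)" if x: "x \<in> carrier_vec n" for x
    unfolding Cx[OF x] using x B by (intro scalar_prod_minus_distrib[of _ n]) auto
  have psd: "pos_semidef n C" unfolding pos_semidef_def
  proof (intro conjI ballI C)
    show "C\<^sup>T = C" unfolding C_def transpose_minus[OF one_carrier_mat B] sym by simp
    show "0 \<le> x \<bullet> (C *\<^sub>v x)" if "x \<in> carrier_vec n" for x using form[OF that] le[OF that] by simp
  qed
  have upper: "x \<bullet> (C *\<^sub>v x) \<le> (1 - \<eta>) * (x \<bullet> x)" if x: "x \<in> carrier_vec n" for x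
    using form[OF x] lambda_min_le_form[OF B sym n x] by (simp add: \<eta>_def algebra_simps)
  have e: "unit_vec n 0 \<in> carrier_vec n" "unit_vec n 0 \<bullet> (unit_vec n 0 :: real vec) = 1" using n by simp_all
  have "0 \<le> unit_vec n 0 \<bullet> (C *\<^sub>v unit_vec n 0)" using psd by (simp add: pos_semidef_def)
  then have \<eta>1: "0 \<le> 1 - \<eta>" using upper[OF e(1)] e(2) by simp
  then show "lambda_min B \<le> 1" by (simp add: \<eta>_def)
  show "vnorm (x - B *\<^sub>v x) \<le> (1 - lambda_min B) * vnorm x" if x: "x \<in> carrier_vec n"
  proof (rule power2_le_imp_le)
    have "(vnorm (x - B *\<^sub>v x))\<^sup>2 = (C *\<^sub>v x) \<bullet> (C *\<^sub>v x)" by (simp add: vnorm_power2 Cx[OF x])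
    also have "\<dots> \<le> (1 - \<eta>) * (x \<bullet> (C *\<^sub>v x))" by (rule psd_image_bound[OF psd x upper])
    also have "\<dots> \<le> (1 - \<eta>) * ((1 - \<eta>) * (x \<bullet> x))" by (rule mult_left_mono[OF upper[OF x] \<eta>1])
    also have "\<dots> = ((1 - lambda_min B) * vnorm x)\<^sup>2"
      by (simp add: \<eta>_def power_mult_distrib vnorm_power2) (simp add: power2_eq_square)
    finally show "(vnorm (x - B *\<^sub>v x))\<^sup>2 \<le> ((1 - lambda_min B) * vnorm x)\<^sup>2" .
    show "0 \<le> (1 - lambda_min B) * vnorm x" using \<eta>1 by (simp add: \<eta>_def)
  qed
qed

text \<open>
  An eigenvector \<open>v\<close> of \<open>M M\<^sup>T\<close> with eigenvalue \<open>0\<close> satisfies \<open>M\<^sup>T v = 0\<close>, so it is orthogonal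
  to the range of \<open>M\<close>, which is the whole space by the rank hypothesis.
\<close>

lemma lambda_min_gram_pos:
  fixes M :: "real mat"
  assumes M: "M \<in> carrier_mat n k" and rank: "mat_rank M = n" and n: "0 < n"
  shows "0 < lambda_min (M * M\<^sup>T)"
proof -
  have MT: "M\<^sup>T \<in> carrier_mat k n" using M by simp
  have N: "M * M\<^sup>T \<in> carrier_mat n n" using M MT by (rule mult_carrier_mat)
  obtain v where v: "v \<in> carrier_vec n" "v \<noteq> 0\<^sub>v n" "M * M\<^sup>T *\<^sub>v v = lambda_min (M * M\<^sup>T) \<cdot>\<^sub>v v"
    using lambda_min_eigenvector[OF N gram_symmetric n] by blast
  have "vec_space.rank n M = n" using rank M by (simp add: mat_rank_def)
  then obtain w where w: "w \<in> carrier_vec k" "M *\<^sub>v w = v" using full_rank_imp_surj[OF M _ v(1)] by blast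
  have vv: "0 < v \<bullet> v" using scalar_prod_self_eq_0_iff[OF v(1)] v(2) scalar_prod_self_nonneg[of v] by linarith
  have form: "lambda_min (M * M\<^sup>T) * (v \<bullet> v) = (M\<^sup>T *\<^sub>v v) \<bullet> (M\<^sup>T *\<^sub>v v)"
    using gram_form[OF M v(1)] v(1) unfolding v(3) by simp
  have MTv: "M\<^sup>T *\<^sub>v v \<in> carrier_vec k" using MT v(1) by simp
  have "(M\<^sup>T *\<^sub>v v) \<bullet> (M\<^sup>T *\<^sub>v v) \<noteq> 0"
  proof
    assume "(M\<^sup>T *\<^sub>v v) \<bullet> (M\<^sup>T *\<^sub>v v) = 0"
    then have "M\<^sup>T *\<^sub>v v = 0\<^sub>v k" using scalar_prod_self_eq_0_iff[OF MTv] by simp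
    then have "v \<bullet> v = 0" using transpose_vec_mult_scalar[OF M w(1) v(1)] w by simp
    with vv show False by simp
  qed
  then have "0 < lambda_min (M * M\<^sup>T) * (v \<bullet> v)"
    using form scalar_prod_self_nonneg[of "M\<^sup>T *\<^sub>v v"] by linarith
  then show ?thesis using vv by (simp add: zero_less_mult_iff)
qed

text \<open>
  The bound \<open>d / \<eta>\<close> is the fixed point of \<open>u \<mapsto> (1 - \<eta>) u + d\<close>.
\<close>

lemma affine_recursion_bound:
  fixes u :: "nat \<Rightarrow> real"
  assumes \<eta>: "0 < \<eta>" "\<eta> \<le> 1" and step: "\<And>k. u (Suc k) \<le> (1 - \<eta>) * u k + d" and d: "0 \<le> d"
  shows "u k \<le> (1 - \<eta>) ^ k * u 0 + d / \<eta>"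
proof (induction k)
  case 0
  then show ?case using d \<eta> by simp
next
  case (Suc k)
  have "u (Suc k) \<le> (1 - \<eta>) * ((1 - \<eta>) ^ k * u 0 + d / \<eta>) + d"
    using step[of k] mult_left_mono[OF Suc, of "1 - \<eta>"] \<eta> by simp
  also have "\<dots> = (1 - \<eta>) ^ Suc k * u 0 + d / \<eta>" using \<eta> by (simp add: field_simps)
  finally show ?case .
qed

section \<open>The expected iterates\<close>

text \<open>
  The history \<open>\<iota> 1, \<dots>, \<iota> k\<close> takes finitely many values, so a function of it is
  measurable and bounded, whatever \<open>F\<close> is. It is independent of the next index, hence the
  expectation of the product factorises.
\<close>

lemma (in prob_space)
  fixes F :: "(nat \<Rightarrow> nat) \<Rightarrow> real" and \<iota> :: "nat \<Rightarrow> 'a \<Rightarrow> nat" and p :: nat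
  assumes ind: "indep_vars (\<lambda>_. count_space {1..p}) \<iota> {1..}"
    and F: "\<And>s s'. (\<And>j. j \<in> {1..k} \<Longrightarrow> s j = s' j) \<Longrightarrow> F s = F s'"
  shows integrable_of_finite_history: "integrable M (\<lambda>\<omega>. F (\<lambda>j. \<iota> j \<omega>))"
    and expectation_fresh_index:
      "expectation (\<lambda>\<omega>. of_bool (\<iota> (Suc k) \<omega> = i) * F (\<lambda>j. \<iota> j \<omega>))
       = prob {\<omega> \<in> space M. \<iota> (Suc k) \<omega> = i} * expectation (\<lambda>\<omega>. F (\<lambda>j. \<iota> j \<omega>))"
proof -
  define hist where "hist = (\<lambda>\<omega>. restrict (\<lambda>j. \<iota> j \<omega>) {1..k})"
  define new where "new = (\<lambda>\<omega>. restrict (\<lambda>j. \<iota> j \<omega>) {Suc k})"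
  define I where "I = (\<lambda>s. of_bool (s (Suc k) = i) :: real)"
  have "indep_var (PiM {Suc k} (\<lambda>_. count_space {1..p})) new (PiM {1..k} (\<lambda>_. count_space {1..p})) hist"
    unfolding hist_def new_def by (rule indep_var_restrict[OF ind]) auto
  then have iv: "indep_var (count_space (PiE {Suc k} (\<lambda>_. {1..p}))) new (count_space (PiE {1..k} (\<lambda>_. {1..p}))) hist"
    by (simp add: count_space_PiM_finite)
  have "indep_var borel (I \<circ> new) borel (F \<circ> hist)" by (rule indep_var_compose[OF iv]) auto
  moreover have Fh: "F \<circ> hist = (\<lambda>\<omega>. F (\<lambda>j. \<iota> j \<omega>))"
    unfolding hist_def o_def by (intro ext F) auto
  moreover have In: "I \<circ> new = (\<lambda>\<omega>. of_bool (\<iota> (Suc k) \<omega> = i))" by (auto simp: I_def new_def)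
  ultimately have iv': "indep_var borel (\<lambda>\<omega>. of_bool (\<iota> (Suc k) \<omega> = i) :: real) borel (\<lambda>\<omega>. F (\<lambda>j. \<iota> j \<omega>))"
    by simp
  from indep_var_rv1[OF iv'] indep_var_rv2[OF iv']
  have meas: "(\<lambda>\<omega>. of_bool (\<iota> (Suc k) \<omega> = i) :: real) \<in> borel_measurable M"
    "(\<lambda>\<omega>. F (\<lambda>j. \<iota> j \<omega>)) \<in> borel_measurable M" by auto
  define R where "R = (\<lambda>s. \<bar>F s\<bar>) ` PiE {1..k} (\<lambda>_. {1..p})"
  have "finite R" unfolding R_def by (intro finite_imageI finite_PiE) auto
  have hist_in: "hist \<omega> \<in> PiE {1..k} (\<lambda>_. {1..p})" if "\<omega> \<in> space M" for \<omega>
    using measurable_space[OF indep_var_rv2[OF iv] that] by simp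
  show int: "integrable M (\<lambda>\<omega>. F (\<lambda>j. \<iota> j \<omega>))"
  proof (rule integrable_const_bound[OF _ meas(2)])
    show "AE \<omega> in M. norm (F (\<lambda>j. \<iota> j \<omega>)) \<le> Max R"
    proof (rule AE_I2)
      fix \<omega> assume "\<omega> \<in> space M"
      then have "\<bar>F (hist \<omega>)\<bar> \<in> R" unfolding R_def using hist_in by blast
      then show "norm (F (\<lambda>j. \<iota> j \<omega>)) \<le> Max R"
        using \<open>finite R\<close> fun_cong[OF Fh, of \<omega>] by simp
    qed
  qed
  have int1: "integrable M (\<lambda>\<omega>. of_bool (\<iota> (Suc k) \<omega> = i) :: real)"
    by (rule integrable_const_bound[OF _ meas(1), of 1]) auto
  have "expectation (\<lambda>\<omega>. of_bool (\<iota> (Suc k) \<omega> = i)) = prob {\<omega> \<in> space M. \<iota> (Suc k) \<omega> = i}"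
  proof -
    have "expectation (\<lambda>\<omega>. of_bool (\<iota> (Suc k) \<omega> = i)) = expectation (indicator {\<omega> \<in> space M. \<iota> (Suc k) \<omega> = i} :: _ \<Rightarrow> real)"
      by (intro Bochner_Integration.integral_cong) (auto simp: indicator_def)
    moreover have "{\<omega> \<in> space M. \<iota> (Suc k) \<omega> = i} \<inter> space M = {\<omega> \<in> space M. \<iota> (Suc k) \<omega> = i}" by blast
    ultimately show ?thesis by simp
  qed
  with indep_var_lebesgue_integral[OF iv' int1 int]
  show "expectation (\<lambda>\<omega>. of_bool (\<iota> (Suc k) \<omega> = i) * F (\<lambda>j. \<iota> j \<omega>))
       = prob {\<omega> \<in> space M. \<iota> (Suc k) \<omega> = i} * expectation (\<lambda>\<omega>. F (\<lambda>j. \<iota> j \<omega>))" by simp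
qed

lemma (in prob_space)
  fixes \<iota> :: "nat \<Rightarrow> 'a \<Rightarrow> nat" and p :: nat
  assumes ind: "indep_vars (\<lambda>_. count_space {1..p}) \<iota> {1..}" and k: "1 \<le> k"
  shows index_range: "\<omega> \<in> space M \<Longrightarrow> \<iota> k \<omega> \<in> {1..p}"
    and sum_index_prob: "(\<Sum>i=1..p. prob {\<omega> \<in> space M. \<iota> k \<omega> = i}) = 1"
proof -
  have rv: "\<iota> k \<in> measurable M (count_space {1..p})" using ind k by (auto simp: indep_vars_def)
  from measurable_space[OF rv] show range: "\<omega> \<in> space M \<Longrightarrow> \<iota> k \<omega> \<in> {1..p}" for \<omega> by simp
  have sets: "{\<omega> \<in> space M. \<iota> k \<omega> = i} \<in> events" for i
  proof (cases "i \<in> {1..p}")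
    case True
    from measurable_sets[OF rv, of "{i}"] True show ?thesis by (simp add: vimage_def Int_def conj_commute)
  next
    case False
    then have "{\<omega> \<in> space M. \<iota> k \<omega> = i} = {}" using range by blast
    then show ?thesis by (simp only: sets.empty_sets)
  qed
  have "(\<Sum>i=1..p. prob {\<omega> \<in> space M. \<iota> k \<omega> = i}) = prob (\<Union>i\<in>{1..p}. {\<omega> \<in> space M. \<iota> k \<omega> = i})"
    using sets by (intro finite_measure_finite_Union[symmetric]) (auto simp: disjoint_family_on_def)
  also have "(\<Union>i\<in>{1..p}. {\<omega> \<in> space M. \<iota> k \<omega> = i}) = space M" using range by blast
  finally show "(\<Sum>i=1..p. prob {\<omega> \<in> space M. \<iota> k \<omega> = i}) = 1" by (simp add: prob_space)
qed

lemma mult_mat_vec_index: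
  assumes "Q \<in> carrier_mat m n" "x \<in> carrier_vec n" "a < m"
  shows "(Q *\<^sub>v x) $ a = (\<Sum>j<n. Q $$ (a, j) * x $ j)"
  using assms by (simp add: scalar_prod_def atLeast0LessThan)

lemma rbk_carrier:
  assumes M: "M \<in> carrier_mat m n" and x0: "x0 \<in> carrier_vec n"
  shows "rbk M c \<tau> x0 s k \<in> carrier_vec n"
proof (induction k)
  case (Suc k)
  have "pinv (row_block M I) \<in> carrier_mat n (card {i. i < m \<and> i \<in> I})" for I
    by (rule pinv_carrier[OF row_block_carrier[OF M]])
  then have "dim_row (pinv (row_block M I)) = n" for I by blast
  then show ?case using Suc by (auto simp: Let_def intro!: carrier_vecI)
qed (use x0 in simp)

lemma rbk_cong:
  "(\<And>j. j \<in> {1..k} \<Longrightarrow> s j = s' j) \<Longrightarrow> rbk M c \<tau> x0 s k = rbk M c \<tau> x0 s' k"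
  by (induction k) (auto simp: Let_def)

text \<open>
  The Kaczmarz step \<open>x + pinv M (c - M x)\<close>, sorted into its linear part \<open>I - pinv M * M\<close>
  and its constant part.
\<close>

definition block_step :: "real mat \<Rightarrow> real vec \<Rightarrow> real vec \<Rightarrow> real vec" where
  "block_step M c x = x - pinv M * M *\<^sub>v x + pinv M *\<^sub>v c"

lemma block_step_eq:
  assumes M: "M \<in> carrier_mat r n" and c: "c \<in> carrier_vec r" and x: "x \<in> carrier_vec n"
  shows "x + pinv M *\<^sub>v (c - M *\<^sub>v x) = block_step M c x"
proof -
  have P: "pinv M \<in> carrier_mat n r" by (rule pinv_carrier[OF M])
  have Mx: "M *\<^sub>v x \<in> carrier_vec r" using M x by simp
  show ?thesis
    unfolding block_step_def mult_minus_distrib_mat_vec[OF P c Mx] pinv_mult_mult_vec[OF M x]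
    using P x c Mx by (intro eq_vecI) auto
qed

lemma block_step_index:
  assumes M: "M \<in> carrier_mat r n" and c: "c \<in> carrier_vec r" and x: "x \<in> carrier_vec n" and a: "a < n"
  shows "block_step M c x $ a = x $ a - (\<Sum>j<n. (pinv M * M) $$ (a, j) * x $ j) + (pinv M *\<^sub>v c) $ a"
proof -
  have Q: "pinv M * M \<in> carrier_mat n n" by (rule pinv_mult_carrier[OF M])
  have P: "pinv M \<in> carrier_mat n r" by (rule pinv_carrier[OF M])
  have "(pinv M * M *\<^sub>v x) $ a = (\<Sum>j<n. (pinv M * M) $$ (a, j) * x $ j)"
    by (rule mult_mat_vec_index[OF Q x a])
  moreover have "dim_vec (pinv M * M *\<^sub>v x) = n" "dim_vec (pinv M *\<^sub>v c) = n" using P by auto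
  ultimately show ?thesis using x a unfolding block_step_def by simp
qed

text \<open>
  Splitting according to the next index and using its independence of the past leaves the
  expectation of one fixed step at the random iterate; as that step is affine, it
  commutes with the expectation.
\<close>

lemma vec_expectation_rbk_Suc:
  assumes samp: "rbk_sampling P M \<tau> p \<iota>" and M: "M \<in> carrier_mat m n" and c: "c \<in> carrier_vec m"
    and x0: "x0 \<in> carrier_vec n" and a: "a < n"
  defines "X \<equiv> (\<lambda>k. vec_expectation P n (\<lambda>\<omega>. rbk M c \<tau> x0 (\<lambda>j. \<iota> j \<omega>) k))"
  shows "X (Suc k) $ a
    = (\<Sum>i=1..p. (frob_norm (row_block M (\<tau> i)))\<^sup>2 / (frob_norm M)\<^sup>2
         * block_step (row_block M (\<tau> i)) (subvec c (\<tau> i)) (X k) $ a)"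
proof -
  interpret prob_space P using samp by (simp add: rbk_sampling_def)
  have ind: "indep_vars (\<lambda>_. count_space {1..p}) \<iota> {1..}" using samp by (simp add: rbk_sampling_def)
  define Y where "Y = (\<lambda>k s. rbk M c \<tau> x0 s k)"
  define f where "f = (\<lambda>i. block_step (row_block M (\<tau> i)) (subvec c (\<tau> i)))"
  have Y: "Y k s \<in> carrier_vec n" for k s unfolding Y_def by (rule rbk_carrier[OF M x0])
  have Y_cong: "Y k s = Y k s'" if "\<And>j. j \<in> {1..k} \<Longrightarrow> s j = s' j" for s s'
    unfolding Y_def using that by (rule rbk_cong)
  have YS: "Y (Suc k) s = f (s (Suc k)) (Y k s)" for s
    unfolding Y_def f_def rbk.simps Let_def
    by (rule block_step_eq[OF row_block_carrier[OF M] subvec_carrier[OF c] rbk_carrier[OF M x0]])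
  have f_index: "f i x $ a = x $ a - (\<Sum>j<n. (pinv (row_block M (\<tau> i)) * row_block M (\<tau> i)) $$ (a, j) * x $ j)
      + (pinv (row_block M (\<tau> i)) *\<^sub>v subvec c (\<tau> i)) $ a" if "x \<in> carrier_vec n" for i x
    unfolding f_def by (rule block_step_index[OF row_block_carrier[OF M] subvec_carrier[OF c] that a])
  have int: "integrable P (\<lambda>\<omega>. Y k (\<lambda>j. \<iota> j \<omega>) $ j)" for j
    by (rule integrable_of_finite_history[OF ind, of k "\<lambda>s. Y k s $ j"]) (use Y_cong in metis)
  have X: "X k $ j = expectation (\<lambda>\<omega>. Y k (\<lambda>j. \<iota> j \<omega>) $ j)" if "j < n" for j k
    using that by (simp add: X_def vec_expectation_def Y_def)
  have Xc: "X k \<in> carrier_vec n" by (simp add: X_def vec_expectation_def)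
  have affine: "expectation (\<lambda>\<omega>. f i (Y k (\<lambda>j. \<iota> j \<omega>)) $ a) = f i (X k) $ a" for i
    unfolding f_index[OF Y] f_index[OF Xc] using int a by (simp add: X prob_space)
  have fint: "integrable P (\<lambda>\<omega>. of_bool (\<iota> (Suc k) \<omega> = i) * f i (Y k (\<lambda>j. \<iota> j \<omega>)) $ a)" for i
    by (rule integrable_of_finite_history[OF ind, of "Suc k" "\<lambda>s. of_bool (s (Suc k) = i) * f i (Y k s) $ a"])
      (use Y_cong in \<open>metis (no_types, lifting) atLeastAtMost_iff le_SucI le_refl Suc_le_eq zero_less_Suc One_nat_def\<close>)
  have "X (Suc k) $ a = expectation (\<lambda>\<omega>. f (\<iota> (Suc k) \<omega>) (Y k (\<lambda>j. \<iota> j \<omega>)) $ a)"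
    unfolding X[OF a] YS ..
  also have "\<dots> = expectation (\<lambda>\<omega>. \<Sum>i=1..p. of_bool (\<iota> (Suc k) \<omega> = i) * f i (Y k (\<lambda>j. \<iota> j \<omega>)) $ a)"
  proof (intro Bochner_Integration.integral_cong refl)
    fix \<omega> assume "\<omega> \<in> space P"
    then have "\<iota> (Suc k) \<omega> \<in> {1..p}" using index_range[OF ind] by simp
    moreover have "(\<Sum>i=1..p. of_bool (\<iota> (Suc k) \<omega> = i) * f i (Y k (\<lambda>j. \<iota> j \<omega>)) $ a)
      = (\<Sum>i=1..p. if i = \<iota> (Suc k) \<omega> then f i (Y k (\<lambda>j. \<iota> j \<omega>)) $ a else 0)"
      by (intro sum.cong) auto
    ultimately show "f (\<iota> (Suc k) \<omega>) (Y k (\<lambda>j. \<iota> j \<omega>)) $ a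
      = (\<Sum>i=1..p. of_bool (\<iota> (Suc k) \<omega> = i) * f i (Y k (\<lambda>j. \<iota> j \<omega>)) $ a)" by simp
  qed
  also have "\<dots> = (\<Sum>i=1..p. expectation (\<lambda>\<omega>. of_bool (\<iota> (Suc k) \<omega> = i) * f i (Y k (\<lambda>j. \<iota> j \<omega>)) $ a))"
    using fint by (intro Bochner_Integration.integral_sum) auto
  also have "\<dots> = (\<Sum>i=1..p. prob {\<omega> \<in> space P. \<iota> (Suc k) \<omega> = i} * f i (X k) $ a)"
  proof (intro sum.cong refl)
    fix i
    have "expectation (\<lambda>\<omega>. of_bool (\<iota> (Suc k) \<omega> = i) * f i (Y k (\<lambda>j. \<iota> j \<omega>)) $ a)
      = prob {\<omega> \<in> space P. \<iota> (Suc k) \<omega> = i} * expectation (\<lambda>\<omega>. f i (Y k (\<lambda>j. \<iota> j \<omega>)) $ a)"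
      by (rule expectation_fresh_index[OF ind, of k "\<lambda>s. f i (Y k s) $ a"]) (use Y_cong in metis)
    then show "expectation (\<lambda>\<omega>. of_bool (\<iota> (Suc k) \<omega> = i) * f i (Y k (\<lambda>j. \<iota> j \<omega>)) $ a)
      = prob {\<omega> \<in> space P. \<iota> (Suc k) \<omega> = i} * f i (X k) $ a" unfolding affine .
  qed
  also have "\<dots> = (\<Sum>i=1..p. (frob_norm (row_block M (\<tau> i)))\<^sup>2 / (frob_norm M)\<^sup>2 * f i (X k) $ a)"
    using samp by (intro sum.cong) (auto simp: rbk_sampling_def)
  finally show ?thesis unfolding f_def .
qed

section \<open>Error of the expected iterates\<close>

text \<open>
  For \<open>z = pinv M c\<close> and \<open>Q = pinv M * M\<close> the vector \<open>z - y\<close> is \<open>(z - x) + (x - y)\<close>, and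
  \<open>x - z = (x - Q x) - pinv M (c - M x)\<close>. Only the first summand is seen under the angle to
  the row space; in the second, \<open>Q\<close> does not increase the norm.
\<close>

lemma block_error_bound:
  fixes M :: "real mat"
  assumes M: "M \<in> carrier_mat r n" and r: "0 < r" and \<alpha>: "0 < \<alpha>" "\<alpha> \<le> lambda_min (M * M\<^sup>T)"
    and c: "c \<in> carrier_vec r" and x: "x \<in> carrier_vec n" and y: "y \<in> carrier_vec n"
  shows "vnorm (pinv M * M *\<^sub>v (pinv M *\<^sub>v c - y))
    \<le> cos_angle (x - pinv M *\<^sub>v c) (vec_space.col_space n M\<^sup>T) * (vnorm x + vnorm (c - M *\<^sub>v x) / sqrt \<alpha>)
      + vnorm (y - x)"
proof -
  define Q where "Q = pinv M * M"
  define z where "z = pinv M *\<^sub>v c"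
  have P: "pinv M \<in> carrier_mat n r" by (rule pinv_carrier[OF M])
  have Q: "Q \<in> carrier_mat n n" unfolding Q_def by (rule pinv_mult_carrier[OF M])
  have z: "z \<in> carrier_vec n" unfolding z_def using P c by (rule mult_mat_vec_carrier)
  have Mx: "M *\<^sub>v x \<in> carrier_vec r" using M x by (rule mult_mat_vec_carrier)
  have zx: "z - x \<in> carrier_vec n" and xy: "x - y \<in> carrier_vec n" and xz: "x - z \<in> carrier_vec n"
    using x y z by auto
  have Qx: "Q *\<^sub>v x \<in> carrier_vec n" using Q x by (rule mult_mat_vec_carrier)
  have res: "c - M *\<^sub>v x \<in> carrier_vec r" using c Mx by simp
  have Pres: "pinv M *\<^sub>v (c - M *\<^sub>v x) \<in> carrier_vec n" using P res by (rule mult_mat_vec_carrier)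
  have "x - z = (x - Q *\<^sub>v x) + (-1) \<cdot>\<^sub>v (pinv M *\<^sub>v (c - M *\<^sub>v x))"
    unfolding z_def Q_def pinv_mult_mult_vec[OF M x] mult_minus_distrib_mat_vec[OF P c Mx]
    using P x by (intro eq_vecI) auto
  also have "vnorm \<dots> \<le> vnorm (x - Q *\<^sub>v x) + vnorm ((-1) \<cdot>\<^sub>v (pinv M *\<^sub>v (c - M *\<^sub>v x)))"
    using x Qx Pres by (intro vnorm_add_le[of _ n]) auto
  also have "\<dots> \<le> vnorm x + vnorm (c - M *\<^sub>v x) / sqrt \<alpha>"
    unfolding Q_def using vnorm_minus_proj_le[OF M x] vnorm_pinv_le[OF M r \<alpha> res]
    by (simp add: vnorm_smult)
  finally have dist: "vnorm (x - z) \<le> vnorm x + vnorm (c - M *\<^sub>v x) / sqrt \<alpha>" .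
  have split: "z - y = (-1) \<cdot>\<^sub>v (x - z) + (x - y)"
    using x y z by (intro eq_vecI) auto
  have "Q *\<^sub>v (z - y) = (-1) \<cdot>\<^sub>v (Q *\<^sub>v (x - z)) + Q *\<^sub>v (x - y)"
    unfolding split using xz xy
    by (simp add: mult_add_distrib_mat_vec[OF Q _ xy] mult_mat_vec[OF Q xz])
  also have "vnorm \<dots> \<le> vnorm ((-1) \<cdot>\<^sub>v (Q *\<^sub>v (x - z))) + vnorm (Q *\<^sub>v (x - y))"
    using mult_mat_vec_carrier[OF Q xz] mult_mat_vec_carrier[OF Q xy]
    by (intro vnorm_add_le[of _ n]) auto
  also have "\<dots> \<le> cos_angle (x - z) (vec_space.col_space n M\<^sup>T) * vnorm (x - z) + vnorm (x - y)"
    unfolding Q_def vnorm_smult cos_angle_row_space(1)[OF M xz]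
    using vnorm_proj_le[OF M xy] by simp
  also have "\<dots> \<le> cos_angle (x - z) (vec_space.col_space n M\<^sup>T)
      * (vnorm x + vnorm (c - M *\<^sub>v x) / sqrt \<alpha>) + vnorm (y - x)"
    using mult_left_mono[OF dist cos_angle_row_space(2)[OF M xz]] vnorm_minus_commute[OF x y] by simp
  finally show ?thesis unfolding Q_def z_def .
qed

lemma row_partition_block_nonempty:
  assumes part: "row_partition m p \<tau>" and i: "i \<in> {1..p}"
  shows "0 < card {j. j < m \<and> j \<in> \<tau> i}"
proof -
  have "\<tau> i \<subseteq> {..<m}" "\<tau> i \<noteq> {}" using part i unfolding row_partition_def by auto
  then have "{j. j < m \<and> j \<in> \<tau> i} \<noteq> {}" by auto
  then show ?thesis by (simp add: card_gt_0_iff)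
qed

lemma block_V_mat_gram_eq_mean_proj:
  fixes M :: "real mat" and \<tau> :: "nat \<Rightarrow> nat set" and V :: "nat \<Rightarrow> real mat"
  assumes M: "M \<in> carrier_mat m n" and ab: "a < n" "b < n"
    and inv: "\<And>i. i \<in> {1..p} \<Longrightarrow>
      row_block M (\<tau> i) * pinv (row_block M (\<tau> i)) = 1\<^sub>m (dim_row (row_block M (\<tau> i)))"
    and svd: "\<And>i. i \<in> {1..p} \<Longrightarrow> full_svd (row_block M (\<tau> i)) (U i) (S i) (V i)"
  shows "(block_V_mat M \<tau> p V * (block_V_mat M \<tau> p V)\<^sup>T) $$ (a, b)
    = (\<Sum>i=1..p. (frob_norm (row_block M (\<tau> i)))\<^sup>2 / (frob_norm M)\<^sup>2
        * (pinv (row_block M (\<tau> i)) * row_block M (\<tau> i)) $$ (a, b))"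
proof -
  define L where "L = (\<lambda>i. leading_cols (mat_rank (row_block M (\<tau> i))) (V i))"
  have blk: "row_block M (\<tau> i) \<in> carrier_mat (dim_row (row_block M (\<tau> i))) n" for i
    using carrier_matD[OF row_block_carrier[OF M]] by (intro carrier_matI) auto
  have L: "\<exists>r. L i \<in> carrier_mat n r" if i: "i \<in> {1..p}" for i
  proof -
    have V: "V i \<in> carrier_mat n n"
      using svd[OF i] unfolding full_svd_def carrier_matD(2)[OF blk] by blast
    have "mat_rank (row_block M (\<tau> i)) \<le> n" using right_inverse_imp_mat_rank[OF blk inv[OF i]] by simp
    from leading_cols_carrier[OF V this] show ?thesis unfolding L_def by blast
  qed
  have "dim_col M = n" using M by simp
  have "(block_V_mat M \<tau> p V * (block_V_mat M \<tau> p V)\<^sup>T) $$ (a, b)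
    = (\<Sum>i=1..p. (frob_norm (row_block M (\<tau> i)))\<^sup>2 / (frob_norm M)\<^sup>2 * (L i * (L i)\<^sup>T) $$ (a, b))"
    unfolding L_def by (rule block_V_mat_gram_index[OF L[unfolded L_def] \<open>dim_col M = n\<close> ab])
  also have "\<dots> = (\<Sum>i=1..p. (frob_norm (row_block M (\<tau> i)))\<^sup>2 / (frob_norm M)\<^sup>2
        * (pinv (row_block M (\<tau> i)) * row_block M (\<tau> i)) $$ (a, b))"
  proof (intro sum.cong refl)
    fix i assume i: "i \<in> {1..p}"
    from proj_eq_leading_cols_gram[OF blk inv[OF i] svd[OF i]]
    have "L i * (L i)\<^sup>T = pinv (row_block M (\<tau> i)) * row_block M (\<tau> i)" by (simp add: L_def)
    then show "(frob_norm (row_block M (\<tau> i)))\<^sup>2 / (frob_norm M)\<^sup>2 * (L i * (L i)\<^sup>T) $$ (a, b)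
      = (frob_norm (row_block M (\<tau> i)))\<^sup>2 / (frob_norm M)\<^sup>2
        * (pinv (row_block M (\<tau> i)) * row_block M (\<tau> i)) $$ (a, b)" by simp
  qed
  finally show ?thesis .
qed

text \<open>
  At \<open>x\<close> the form of a projector is the squared norm of the projection of \<open>x\<close>, at most that
  of \<open>x\<close>; averaging preserves this bound.
\<close>

lemma mean_proj_form_le:
  fixes B :: "real mat" and D :: "nat \<Rightarrow> real mat"
  assumes B: "B \<in> carrier_mat n n" and x: "x \<in> carrier_vec n"
    and q: "\<And>i. i \<in> I \<Longrightarrow> 0 \<le> q i" "(\<Sum>i\<in>I. q i) = 1"
    and D: "\<And>i. i \<in> I \<Longrightarrow> D i \<in> carrier_mat (d i) n"
    and Bx: "\<And>a. a < n \<Longrightarrow> (B *\<^sub>v x) $ a = (\<Sum>i\<in>I. q i * (pinv (D i) * D i *\<^sub>v x) $ a)"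
  shows "x \<bullet> (B *\<^sub>v x) \<le> x \<bullet> x"
proof -
  have dim: "dim_vec (pinv (D i) * D i *\<^sub>v x) = n" if "i \<in> I" for i
    by (rule carrier_vecD[OF mult_mat_vec_carrier[OF pinv_mult_carrier[OF D[OF that]] x]])
  have "x \<bullet> (B *\<^sub>v x) = (\<Sum>a<n. x $ a * (B *\<^sub>v x) $ a)"
    unfolding scalar_prod_def using B by (simp add: atLeast0LessThan del: index_mult_mat_vec)
  also have "\<dots> = (\<Sum>a<n. \<Sum>i\<in>I. q i * (x $ a * (pinv (D i) * D i *\<^sub>v x) $ a))"
    by (intro sum.cong refl) (simp add: Bx sum_distrib_left mult.left_commute del: index_mult_mat_vec)
  also have "\<dots> = (\<Sum>i\<in>I. \<Sum>a<n. q i * (x $ a * (pinv (D i) * D i *\<^sub>v x) $ a))" by (rule sum.swap)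
  also have "\<dots> = (\<Sum>i\<in>I. q i * (x \<bullet> (pinv (D i) * D i *\<^sub>v x)))"
  proof (intro sum.cong refl)
    fix i assume i: "i \<in> I"
    show "(\<Sum>a<n. q i * (x $ a * (pinv (D i) * D i *\<^sub>v x) $ a)) = q i * (x \<bullet> (pinv (D i) * D i *\<^sub>v x))"
      unfolding scalar_prod_def dim[OF i] atLeast0LessThan by (rule sum_distrib_left[symmetric])
  qed
  also have "\<dots> \<le> (\<Sum>i\<in>I. q i * (x \<bullet> x))"
  proof (intro sum_mono mult_left_mono q)
    fix i assume i: "i \<in> I"
    show "x \<bullet> (pinv (D i) * D i *\<^sub>v x) \<le> x \<bullet> x"
      using proj_form[OF D[OF i] x] proj_pythagoras[OF D[OF i] x]
        scalar_prod_self_nonneg[of "x - pinv (D i) * D i *\<^sub>v x"] by linarith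
  qed
  also have "\<dots> = x \<bullet> x" using q(2) by (simp add: sum_distrib_right[symmetric])
  finally show ?thesis .
qed

theorem theorem4p6:
  fixes A A' :: "real mat" and b b' x0 :: "real vec"
    and m n p k :: nat and \<tau> :: "nat \<Rightarrow> nat set" and \<alpha>\<^sub>1 \<alpha>\<^sub>2 :: real
    and U S V :: "nat \<Rightarrow> real mat"
    and P :: "'w measure" and \<iota> :: "nat \<Rightarrow> 'w \<Rightarrow> nat"
  defines "x_LS \<equiv> pinv A *\<^sub>v b"
    and "x_LS' \<equiv> pinv A' *\<^sub>v b'"
    and "x_LS_block \<equiv> (\<lambda>i. pinv (row_block A' (\<tau> i)) *\<^sub>v subvec b' (\<tau> i))"
    and "A\<^sub>\<tau> \<equiv> block_V_mat A' \<tau> p V"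
  defines "cos_\<theta> \<equiv> Max ((\<lambda>i. cos_angle (x_LS' - x_LS_block i)
                               (vec_space.col_space n (row_block A' (\<tau> i))\<^sup>T)) ` {1..p})"
    and "\<eta> \<equiv> lambda_min (A\<^sub>\<tau> * A\<^sub>\<tau>\<^sup>T)"
    and "r \<equiv> b' - A' *\<^sub>v x_LS'"
    and "e_LS \<equiv> x_LS - x_LS'"
  assumes "A \<in> carrier_mat m n" and "A' \<in> carrier_mat m n"
    and "b \<in> carrier_vec m" and "b' \<in> carrier_vec m"
    and "row_paving A' \<tau> p \<alpha>\<^sub>1 \<alpha>\<^sub>2"
    and "\<And>i. i \<in> {1..p} \<Longrightarrow> full_svd (row_block A' (\<tau> i)) (U i) (S i) (V i)"
    and full_row_rank: "mat_rank A\<^sub>\<tau> = n"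
    and "rbk_sampling P A' \<tau> p \<iota>"
    and "x0 \<in> carrier_vec n" and "k \<ge> 1"
  shows "vnorm (vec_expectation P n (\<lambda>\<omega>. rbk A' b' \<tau> x0 (\<lambda>j. \<iota> j \<omega>) k - x_LS))
         \<le> (1 - \<eta>) ^ k * vnorm (x0 - x_LS)
           + (cos_\<theta> * (vnorm x_LS' + vnorm r / sqrt \<alpha>\<^sub>1) + vnorm e_LS) / \<eta>"
proof -
  note A = \<open>A \<in> carrier_mat m n\<close> and A' = \<open>A' \<in> carrier_mat m n\<close>
    and b = \<open>b \<in> carrier_vec m\<close> and b' = \<open>b' \<in> carrier_vec m\<close>
    and svd = \<open>\<And>i. i \<in> {1..p} \<Longrightarrow> full_svd (row_block A' (\<tau> i)) (U i) (S i) (V i)\<close>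
    and samp = \<open>rbk_sampling P A' \<tau> p \<iota>\<close> and x0 = \<open>x0 \<in> carrier_vec n\<close>
  interpret prob_space P using samp by (simp add: rbk_sampling_def)
  have ind: "indep_vars (\<lambda>_. count_space {1..p}) \<iota> {1..}" using samp by (simp add: rbk_sampling_def)
  have part: "row_partition m p \<tau>" and \<alpha>: "0 < \<alpha>\<^sub>1"
    and \<alpha>_le: "\<And>i. i \<in> {1..p} \<Longrightarrow> \<alpha>\<^sub>1 \<le> lambda_min (row_block A' (\<tau> i) * (row_block A' (\<tau> i))\<^sup>T)"
    using \<open>row_paving A' \<tau> p \<alpha>\<^sub>1 \<alpha>\<^sub>2\<close> A' by (auto simp: row_paving_def)
  have xLS: "x_LS \<in> carrier_vec n" and xLS': "x_LS' \<in> carrier_vec n"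
    unfolding x_LS_def x_LS'_def
    using mult_mat_vec_carrier[OF pinv_carrier[OF A] b] mult_mat_vec_carrier[OF pinv_carrier[OF A'] b'] by auto
  define D where "D = (\<lambda>i. row_block A' (\<tau> i))"
  define d where "d = (\<lambda>i. card {j. j < m \<and> j \<in> \<tau> i})"
  define c where "c = (\<lambda>i. subvec b' (\<tau> i))"
  define q where "q = (\<lambda>i. (frob_norm (D i))\<^sup>2 / (frob_norm A')\<^sup>2)"
  define Q where "Q = (\<lambda>i. pinv (D i) * D i)"
  define B where "B = A\<^sub>\<tau> * A\<^sub>\<tau>\<^sup>T"
  define h where "h = (\<lambda>i. Q i *\<^sub>v (pinv (D i) *\<^sub>v c i - x_LS))"
  define drift where "drift = vec n (\<lambda>a. \<Sum>i=1..p. q i * h i $ a)"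
  define E where "E = (\<lambda>k. vec_expectation P n (\<lambda>\<omega>. rbk A' b' \<tau> x0 (\<lambda>j. \<iota> j \<omega>) k))"
  define \<beta> where "\<beta> = cos_\<theta> * (vnorm x_LS' + vnorm r / sqrt \<alpha>\<^sub>1) + vnorm e_LS"
  have D: "D i \<in> carrier_mat (d i) n" for i unfolding D_def d_def by (rule row_block_carrier[OF A'])
  have c: "c i \<in> carrier_vec (d i)" for i unfolding c_def d_def by (rule subvec_carrier[OF b'])
  have d: "0 < d i" if "i \<in> {1..p}" for i unfolding d_def by (rule row_partition_block_nonempty[OF part that])
  have Q: "Q i \<in> carrier_mat n n" for i unfolding Q_def by (rule pinv_mult_carrier[OF D])
  have Pc: "pinv (D i) *\<^sub>v c i \<in> carrier_vec n" for i
    using pinv_carrier[OF D] c by (rule mult_mat_vec_carrier)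
  have h: "h i \<in> carrier_vec n" for i
    unfolding h_def using Q Pc xLS by (intro mult_mat_vec_carrier[of _ n n]) auto
  have inv: "D i * pinv (D i) = 1\<^sub>m (d i)" if "i \<in> {1..p}" for i
    using lambda_min_gram_pos_imp_right_inverse[OF D d[OF that]] \<alpha> \<alpha>_le[OF that] by (simp add: D_def)
  have q0: "0 \<le> q i" for i by (simp add: q_def)
  have q1: "(\<Sum>i=1..p. q i) = 1"
  proof -
    have "(\<Sum>i=1..p. q i) = (\<Sum>i=1..p. prob {\<omega> \<in> space P. \<iota> 1 \<omega> = i})"
      using samp by (intro sum.cong) (auto simp: rbk_sampling_def q_def D_def)
    then show ?thesis using sum_index_prob[OF ind order_refl] by simp
  qed
  \<comment> \<open>There is a block; its nonempty set of rows is linearly independent, so \<open>n\<close> is positive.\<close>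
  then have p: "1 \<in> {1..p}" by (cases "p = 0") auto
  have n: "0 < n" using right_inverse_imp_mat_rank(2)[OF D inv[OF p]] d[OF p] by simp

  \<comment> \<open>The Gram matrix of the concatenated singular vectors is the average projector.\<close>
  have At: "A\<^sub>\<tau> \<in> carrier_mat n (dim_col A\<^sub>\<tau>)"
    unfolding A\<^sub>\<tau>_def by (rule block_V_mat_carrier[OF carrier_matD(2)[OF A']])
  have B: "B \<in> carrier_mat n n"
    unfolding B_def by (rule mult_carrier_mat[OF At transpose_carrier_mat[THEN iffD2, OF At]])
  have B_sym: "B\<^sup>T = B" unfolding B_def by (rule gram_symmetric)
  have B_index: "B $$ (a, a') = (\<Sum>i=1..p. q i * Q i $$ (a, a'))" if "a < n" "a' < n" for a a'
    unfolding B_def A\<^sub>\<tau>_def q_def Q_def D_def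
  proof (rule block_V_mat_gram_eq_mean_proj[OF A' that])
    fix i assume i: "i \<in> {1..p}"
    show "full_svd (row_block A' (\<tau> i)) (U i) (S i) (V i)" by (rule svd[OF i])
    show "row_block A' (\<tau> i) * pinv (row_block A' (\<tau> i)) = 1\<^sub>m (dim_row (row_block A' (\<tau> i)))"
      using inv[OF i] carrier_matD(1)[OF D[of i]] unfolding D_def by metis
  qed
  have Bx: "(B *\<^sub>v x) $ a = (\<Sum>i=1..p. q i * (Q i *\<^sub>v x) $ a)" if "x \<in> carrier_vec n" "a < n" for x a
  proof -
    have "(B *\<^sub>v x) $ a = (\<Sum>j<n. \<Sum>i=1..p. q i * (Q i $$ (a, j) * x $ j))"
      unfolding mult_mat_vec_index[OF B that] using that
      by (intro sum.cong refl) (simp add: B_index sum_distrib_right mult.assoc)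
    also have "\<dots> = (\<Sum>i=1..p. \<Sum>j<n. q i * (Q i $$ (a, j) * x $ j))" by (rule sum.swap)
    also have "\<dots> = (\<Sum>i=1..p. q i * (Q i *\<^sub>v x) $ a)"
      unfolding mult_mat_vec_index[OF Q that] sum_distrib_left ..
    finally show ?thesis .
  qed
  have B_le: "x \<bullet> (B *\<^sub>v x) \<le> x \<bullet> x" if "x \<in> carrier_vec n" for x
    by (rule mean_proj_form_le[OF B that q0 q1 D]) (rule Bx[OF that, unfolded Q_def])
  have contraction: "vnorm (x - B *\<^sub>v x) \<le> (1 - \<eta>) * vnorm x" if "x \<in> carrier_vec n" for x
    unfolding \<eta>_def B_def[symmetric] by (rule symmetric_contraction(2)[OF B B_sym n _ that]) (rule B_le)
  have \<eta>1: "\<eta> \<le> 1"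
    unfolding \<eta>_def B_def[symmetric] by (rule symmetric_contraction(1)[OF B B_sym n]) (rule B_le)
  have \<eta>0: "0 < \<eta>" unfolding \<eta>_def by (rule lambda_min_gram_pos[OF At full_row_rank n])

  \<comment> \<open>Every block displaces the mean error by at most \<open>\<beta>\<close>, hence so does their average.\<close>
  have cos_le: "cos_angle (x_LS' - x_LS_block i) (vec_space.col_space n (D i)\<^sup>T) \<le> cos_\<theta>" if "i \<in> {1..p}" for i
    unfolding cos_\<theta>_def D_def using that by (intro Max_ge) auto
  have h_le: "vnorm (h i) \<le> \<beta>" if i: "i \<in> {1..p}" for i
  proof -
    have "c i - D i *\<^sub>v x_LS' = subvec r (\<tau> i)"
      unfolding c_def D_def r_def row_block_mult_vec[OF A' xLS']
      by (rule subvec_minus[OF b' mult_mat_vec_carrier[OF A' xLS'], symmetric])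
    then have res: "vnorm (c i - D i *\<^sub>v x_LS') \<le> vnorm r" using vnorm_subvec_le by simp
    have "\<alpha>\<^sub>1 \<le> lambda_min (D i * (D i)\<^sup>T)" using \<alpha>_le[OF i] by (simp add: D_def)
    then have "vnorm (h i) \<le> cos_angle (x_LS' - x_LS_block i) (vec_space.col_space n (D i)\<^sup>T)
        * (vnorm x_LS' + vnorm (c i - D i *\<^sub>v x_LS') / sqrt \<alpha>\<^sub>1) + vnorm e_LS"
      using block_error_bound[OF D d[OF i] \<alpha> _ c xLS' xLS]
      by (simp add: h_def Q_def x_LS_block_def D_def c_def e_LS_def)
    also have "\<dots> \<le> cos_\<theta> * (vnorm x_LS' + vnorm r / sqrt \<alpha>\<^sub>1) + vnorm e_LS"
    proof (intro add_right_mono mult_mono cos_le[OF i] add_left_mono divide_right_mono res)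
      have "x_LS' - x_LS_block i \<in> carrier_vec n"
        using xLS' Pc by (simp add: x_LS_block_def D_def c_def)
      from cos_angle_row_space(2)[OF D this, of i] show "0 \<le> cos_\<theta>" using cos_le[OF i] by linarith
    qed (use \<alpha> in auto)
    finally show ?thesis by (simp add: \<beta>_def)
  qed
  have "vnorm drift \<le> (\<Sum>i=1..p. q i * vnorm (h i))"
    unfolding drift_def using q0 h by (intro vnorm_weighted_sum_le) auto
  also have "\<dots> \<le> (\<Sum>i=1..p. q i * \<beta>)"
    using q0 h_le by (intro sum_mono mult_left_mono) auto
  also have "\<dots> = \<beta>" using q1 by (simp add: sum_distrib_right[symmetric])
  finally have drift_le: "vnorm drift \<le> \<beta>" .
  have \<beta>0: "0 \<le> \<beta>" using drift_le vnorm_nonneg[of drift] by linarith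

  \<comment> \<open>As the probabilities sum to \<open>1\<close>, \<open>x_LS\<close> can be subtracted inside the average over
    the blocks.\<close>
  have E: "E k \<in> carrier_vec n" for k by (simp add: E_def vec_expectation_def)
  have E_Suc: "E (Suc k) - x_LS = ((E k - x_LS) - B *\<^sub>v (E k - x_LS)) + drift" for k
  proof (rule eq_vecI)
    fix a assume "a < dim_vec (((E k - x_LS) - B *\<^sub>v (E k - x_LS)) + drift)"
    then have a: "a < n" by (simp add: drift_def)
    define e where "e = E k - x_LS"
    have e: "e \<in> carrier_vec n" unfolding e_def using E xLS by simp
    have step: "block_step (D i) (c i) (E k) $ a - x_LS $ a = e $ a - (Q i *\<^sub>v e) $ a + h i $ a" for i
    proof -
      have QD: "pinv (D i) * D i = Q i" by (simp add: Q_def)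
      have Qe: "Q i *\<^sub>v e = Q i *\<^sub>v E k - Q i *\<^sub>v x_LS"
        unfolding e_def by (rule mult_minus_distrib_mat_vec[OF Q E xLS])
      have hi: "h i = pinv (D i) *\<^sub>v c i - Q i *\<^sub>v x_LS"
        unfolding h_def mult_minus_distrib_mat_vec[OF Q Pc xLS]
        by (simp add: Q_def proj_pinv_vec[OF D c])
      have dims: "dim_vec (Q i *\<^sub>v E k) = n" "dim_vec (Q i *\<^sub>v x_LS) = n"
          "dim_vec (pinv (D i) *\<^sub>v c i) = n" "dim_vec (E k) = n" "dim_vec x_LS = n"
        using mult_mat_vec_carrier[OF Q E] mult_mat_vec_carrier[OF Q xLS] Pc E xLS
        by (auto simp only: carrier_vecD)
      show ?thesis
        unfolding block_step_def QD Qe hi unfolding e_def using a dims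
        by (simp del: index_mult_mat_vec dim_mult_mat_vec)
    qed
    have "E (Suc k) $ a = (\<Sum>i=1..p. q i * block_step (D i) (c i) (E k) $ a)"
      unfolding E_def q_def D_def c_def by (rule vec_expectation_rbk_Suc[OF samp A' b' x0 a])
    then have "(E (Suc k) - x_LS) $ a = (\<Sum>i=1..p. q i * block_step (D i) (c i) (E k) $ a) - x_LS $ a"
      using a xLS by simp
    also have "\<dots> = (\<Sum>i=1..p. q i * block_step (D i) (c i) (E k) $ a) - (\<Sum>i=1..p. q i) * x_LS $ a"
      unfolding q1 by simp
    also have "\<dots> = (\<Sum>i=1..p. q i * (block_step (D i) (c i) (E k) $ a - x_LS $ a))"
      unfolding right_diff_distrib sum_subtractf sum_distrib_right ..
    also have "\<dots> = (\<Sum>i=1..p. q i) * e $ a - (B *\<^sub>v e) $ a + (\<Sum>i=1..p. q i * h i $ a)"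
      unfolding step Bx[OF e a] distrib_left right_diff_distrib sum.distrib sum_subtractf sum_distrib_right ..
    also have "\<dots> = ((e - B *\<^sub>v e) + drift) $ a"
      unfolding q1 using a carrier_vecD[OF mult_mat_vec_carrier[OF B e]] e
      by (simp add: drift_def del: index_mult_mat_vec dim_mult_mat_vec)
    finally show "(E (Suc k) - x_LS) $ a = (((E k - x_LS) - B *\<^sub>v (E k - x_LS)) + drift) $ a"
      unfolding e_def .
  qed (use xLS in \<open>simp add: drift_def\<close>)
  have step: "vnorm (E (Suc k) - x_LS) \<le> (1 - \<eta>) * vnorm (E k - x_LS) + \<beta>" for k
  proof -
    have e: "E k - x_LS \<in> carrier_vec n" using E xLS by simp
    have "vnorm (E (Suc k) - x_LS) \<le> vnorm ((E k - x_LS) - B *\<^sub>v (E k - x_LS)) + vnorm drift"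
      unfolding E_Suc using e mult_mat_vec_carrier[OF B e]
      by (intro vnorm_add_le[of _ n]) (auto simp: drift_def)
    also have "\<dots> \<le> (1 - \<eta>) * vnorm (E k - x_LS) + \<beta>"
      using contraction[OF e] drift_le by (rule add_mono)
    finally show ?thesis .
  qed
  have E0: "E 0 = x0"
    using x0 by (intro eq_vecI) (auto simp: E_def vec_expectation_def prob_space)
  have "vec_expectation P n (\<lambda>\<omega>. rbk A' b' \<tau> x0 (\<lambda>j. \<iota> j \<omega>) k - x_LS) = E k - x_LS"
  proof (rule eq_vecI)
    fix a assume "a < dim_vec (E k - x_LS)"
    then have a: "a < n" using xLS by simp
    have int: "integrable P (\<lambda>\<omega>. rbk A' b' \<tau> x0 (\<lambda>j. \<iota> j \<omega>) k $ a)"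
      by (rule integrable_of_finite_history[OF ind, of k "\<lambda>s. rbk A' b' \<tau> x0 s k $ a"])
        (use rbk_cong in metis)
    show "vec_expectation P n (\<lambda>\<omega>. rbk A' b' \<tau> x0 (\<lambda>j. \<iota> j \<omega>) k - x_LS) $ a = (E k - x_LS) $ a"
      using a xLS int by (simp add: vec_expectation_def E_def prob_space)
  qed (use xLS in \<open>simp add: vec_expectation_def\<close>)
  then show ?thesis
    using affine_recursion_bound[where u = "\<lambda>k. vnorm (E k - x_LS)", OF \<eta>0 \<eta>1 step \<beta>0, of k] unfolding E0 \<beta>_def by simp
qed

end
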